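(* Let $F$ be a field with a valuation $v$, let $E/F$ be a finite field extension, and let $w$ be a quasi-valuation on $E$ extending $v$. Then there exists a valuation $u$ of $E$ extending $v$ such that $O_u\supseteq O_w$, $I_u\supseteq I_w$ and $u$ dominates $w$, i.e. $w(x)\le u(x)$ for every $x\in E$, the comparison being made in the totally ordered set $\overline T$ (with $\infty$ adjoined) defined in the context.
   Context: A totally ordered abelian monoid is a commutative monoid $(M,+)$ with a total order such that $a\le b$ implies $a+c\le b+c$. One adjoins $\infty$, greater than all elements of $M$, with $m+\infty=\infty$. A quasi-valuation on a ring $A$ is a function $w:A\to M\cup\{\infty\}$, $M$ a totally ordered abelian monoid, with $w(0)=\infty$, $w(xy)\ge w(x)+w(y)$ and $w(x+y)\ge\min\{w(x),w(y)\}$ for all $x,y\in A$. $w$ extends $v$ means that the value group $\Gamma_v$ of $v$ is contained in $M$ as an ordered submonoid and $w|_F=v$. Put $O_w=\{x\in E\mid w(x)\ge 0\}$, $I_w=\{x\in E\mid w(x)>0\}$; $O_u$, $I_u$ are the valuation ring and the valuation ideal of $u$. $M_w$ is the submonoid of $M$ generated by $w(E\setminus\{0\})$. For $x\neq 0$ one has $w(x)\ne\infty$. Ordering. Write $\Gamma=\Gamma_v$, $M=M_w$. $\Gamma_{\text{div}}$ is the divisible hull of $\Gamma$, its elements written $(\gamma,n)$ with $\gamma\in\Gamma$, $n\in\mathbb N$ ($n\ge 1$), where $(\gamma_1,n_1)=(\gamma_2,n_2)$ iff $n_2\gamma_1=n_1\gamma_2$; the value group of any valuation $u$ of $E$ extending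 $v$ is torsion over $\Gamma$ and is regarded as a subgroup of $\Gamma_{\text{div}}$. $M_{\text{div}}=(M\times\mathbb N)/\equiv$, where $(m_1,n_1)\equiv(m_2,n_2)$ iff $tn_2m_1=tn_1m_2$ for some $t\in\mathbb N$, ordered by $(m_1,n_1)\le(m_2,n_2)$ iff $tn_2m_1\le tn_1m_2$ for some $t\in\mathbb N$. Let $T$ be the disjoint union of $M$ and $\Gamma_{\text{div}}$ and let $\varphi:T\to M_{\text{div}}$ be $\varphi(m)=(m,1)$ for $m\in M$, $\varphi((\gamma,n))=(\gamma,n)$ for $(\gamma,n)\in\Gamma_{\text{div}}$. For $x,y\in T$ let $x\sim y$ iff $x=y$ in case $x,y\in M$, and iff $\varphi(x)=\varphi(y)$ otherwise; this is an equivalence relation. An element $x\in M$ is singular if $x\sim y$ implies $x=y$. On $\overline T=T/\sim$ define the total order: $[x]\le[y]$ iff $x\le y$ when $x,y$ are both singular, and iff $\varphi(x)\le\varphi(y)$ otherwise. "$w(x)\le u(x)$" for $x\ne 0$ means $[w(x)]\le[u(x)]$ in $\overline T$ with $w(x)\in M_w$, $u(x)\in\Gamma_{\text{div}}$; for $x=0$ both values are $\infty$. *)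

theory Defs
  imports Complex_Main
begin

section \<open>Adjoining infinity\<close>

datatype 'a with_inf = Fin 'a | Infty

instantiation with_inf :: (comm_monoid_add) comm_monoid_add
begin

definition zero_with_inf :: "'a with_inf" where
  "0 = Fin 0"

fun plus_with_inf :: "'a with_inf \<Rightarrow> 'a with_inf \<Rightarrow> 'a with_inf" where
  "Fin a + Fin b = Fin (a + b)"
| "Fin a + Infty = Infty"
| "Infty + b = Infty"

instance
proof
  fix a b c :: "'a with_inf"
  show "a + b + c = a + (b + c)"
    by (cases a; cases b; cases c) (simp_all add: add.assoc)
  show "a + b = b + a"
    by (cases a; cases b) (simp_all add: add.commute)
  show "0 + a = a"
    by (cases a) (simp_all add: zero_with_inf_def)
qed

end

instantiation with_inf :: (linorder) linorder
begin

fun less_eq_with_inf :: "'a with_inf \<Rightarrow> 'a with_inf \<Rightarrow> bool" where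
  "Fin a \<le> Fin b \<longleftrightarrow> a \<le> b"
| "Infty \<le> Fin b \<longleftrightarrow> False"
| "a \<le> Infty \<longleftrightarrow> True"

definition less_with_inf :: "'a with_inf \<Rightarrow> 'a with_inf \<Rightarrow> bool" where
  "x < y \<longleftrightarrow> x \<le> y \<and> \<not> y \<le> (x :: 'a with_inf)"

instance
proof
  fix x y z :: "'a with_inf"
  show "x < y \<longleftrightarrow> x \<le> y \<and> \<not> y \<le> x"
    by (rule less_with_inf_def)
  show "x \<le> x"
    by (cases x) simp_all
  show "x \<le> z" if "x \<le> y" "y \<le> z"
    using that by (cases x; cases y; cases z) simp_all
  show "x = y" if "x \<le> y" "y \<le> x"
    using that by (cases x; cases y) simp_all
  show "x \<le> y \<or> y \<le> x"
    by (cases x; cases y) auto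
qed

end

instance with_inf :: ("{ordered_comm_monoid_add, linorder}") ordered_comm_monoid_add
proof
  fix a b c :: "'a with_inf"
  show "c + a \<le> c + b" if "a \<le> b"
    using that by (cases a; cases b; cases c) (simp_all add: add_left_mono)
qed


section \<open>Multiples in a commutative monoid\<close>

primrec nmult :: "nat \<Rightarrow> 'a::comm_monoid_add \<Rightarrow> 'a" where
  "nmult 0 a = 0"
| "nmult (Suc n) a = a + nmult n a"

lemma nmult_zero [simp]: "nmult n 0 = 0"
  by (induction n) simp_all

lemma nmult_one [simp]: "nmult (Suc 0) a = a"
  by simp

lemma nmult_add: "nmult (m + n) a = nmult m a + nmult n a"
  by (induction m) (simp_all add: add.assoc)

lemma nmult_plus: "nmult n (a + b) = nmult n a + nmult n b"
  by (induction n) (simp_all add: add_ac)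

lemma nmult_nmult: "nmult m (nmult n a) = nmult (m * n) a"
  by (induction m) (simp_all add: nmult_add)

lemma nmult_uminus: "nmult n (- a) = - nmult n (a :: 'a::ab_group_add)"
  by (induction n) simp_all

lemma nmult_mono:
  "a \<le> b \<Longrightarrow> nmult n a \<le> nmult n (b :: 'a::ordered_comm_monoid_add)"
  by (induction n) (simp_all add: add_mono)

lemma nmult_strict_mono:
  "0 < n \<Longrightarrow> a < b \<Longrightarrow> nmult n a < nmult n (b :: 'a::linordered_ab_group_add)"
proof (induction n)
  case (Suc n)
  then show ?case
    by (cases "n = 0") (simp_all add: add_strict_mono)
qed simp

lemma nmult_le_iff:
  "0 < n \<Longrightarrow> nmult n a \<le> nmult n (b :: 'a::linordered_ab_group_add) \<longleftrightarrow> a \<le> b"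
  by (meson linorder_not_le nmult_mono nmult_strict_mono)

lemma nmult_eq_iff:
  "0 < n \<Longrightarrow> nmult n a = nmult n (b :: 'a::linordered_ab_group_add) \<longleftrightarrow> a = b"
  by (metis nmult_le_iff order_antisym order_refl)


section \<open>The divisible hull of a totally ordered abelian group\<close>

definition hull_rel :: "'g::linordered_ab_group_add \<times> nat \<Rightarrow> 'g \<times> nat \<Rightarrow> bool" where
  "hull_rel = (\<lambda>(a, m) (b, n). 0 < m \<and> 0 < n \<and> nmult n a = nmult m b)"

lemma part_equivp_hull_rel:
  "part_equivp (hull_rel :: 'a::linordered_ab_group_add \<times> nat \<Rightarrow> _)"
proof (rule part_equivpI)
  show "\<exists>x. hull_rel x x"
    by (auto simp: hull_rel_def intro!: exI[of _ "Suc 0"])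
  show "symp hull_rel"
    by (auto simp: hull_rel_def symp_def)
  show "transp (hull_rel :: 'a \<times> nat \<Rightarrow> _)"
  proof (rule transpI)
    fix x y z :: "'a \<times> nat"
    assume xy: "hull_rel x y" and yz: "hull_rel y z"
    obtain a l b m c n where xyz: "x = (a, l)" "y = (b, m)" "z = (c, n)"
      by (metis surj_pair)
    have *: "nmult m a = nmult l b" "nmult n b = nmult m c" and pos: "0 < l" "0 < m" "0 < n"
      using xy yz by (auto simp: hull_rel_def xyz)
    have "nmult m (nmult n a) = nmult n (nmult m a)"
      by (simp add: nmult_nmult mult.commute)
    also have "\<dots> = nmult l (nmult n b)"
      unfolding *(1) by (simp add: nmult_nmult mult.commute)
    also have "\<dots> = nmult m (nmult l c)"
      unfolding *(2) by (simp add: nmult_nmult mult.commute)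
    finally show "hull_rel x z"
      by (simp add: hull_rel_def xyz nmult_eq_iff pos)
  qed
qed

quotient_type (overloaded) 'g div_hull = "'g::linordered_ab_group_add \<times> nat" / partial: hull_rel
  by (rule part_equivp_hull_rel)

text \<open>\<open>hfrac a n\<close> is the element \<open>(a, n)\<close>; it is meaningful only for \<open>0 < n\<close>.\<close>

lift_definition hfrac :: "'g::linordered_ab_group_add \<Rightarrow> nat \<Rightarrow> 'g div_hull"
  is "\<lambda>a n. if n = 0 then (0, 1) else (a, n)"
  by (simp add: hull_rel_def)

lemma hfrac_eq_iff:
  "0 < m \<Longrightarrow> 0 < n \<Longrightarrow> hfrac a m = hfrac b n \<longleftrightarrow> nmult n a = nmult m b"
  by transfer (simp add: hull_rel_def)

lemma hull_cases:
  obtains a n where "0 < n" "x = hfrac a n"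
proof -
  have "\<exists>a n. 0 < n \<and> x = hfrac a n"
    by transfer (auto simp: hull_rel_def split: prod.splits)
  then show ?thesis
    using that by blast
qed

instantiation div_hull :: (linordered_ab_group_add) linordered_ab_group_add
begin

lift_definition zero_div_hull :: "'a div_hull" is "(0, 1)"
  by (simp add: hull_rel_def)

lift_definition plus_div_hull :: "'a div_hull \<Rightarrow> 'a div_hull \<Rightarrow> 'a div_hull"
  is "\<lambda>(a, m) (b, n). (nmult n a + nmult m b, m * n)"
proof (clarsimp simp: hull_rel_def nmult_plus nmult_nmult)
  fix a a' b b' :: 'a and m m' n n' :: nat
  assume "nmult m' a = nmult m a'" "nmult n' b = nmult n b'"
  then have "nmult (n * n') (nmult m' a) = nmult (n * n') (nmult m a')"
    and "nmult (m * m') (nmult n' b) = nmult (m * m') (nmult n b')"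
    by simp_all
  then show "nmult (m' * n' * n) a + nmult (m' * n' * m) b =
      nmult (m * n * n') a' + nmult (m * n * m') b'"
    by (simp add: nmult_nmult mult_ac)
qed

lift_definition uminus_div_hull :: "'a div_hull \<Rightarrow> 'a div_hull" is "\<lambda>(a, n). (- a, n)"
  by (auto simp: hull_rel_def nmult_uminus)

definition minus_div_hull :: "'a div_hull \<Rightarrow> 'a div_hull \<Rightarrow> 'a div_hull" where
  "x - y = x + - (y :: 'a div_hull)"

lift_definition less_eq_div_hull :: "'a div_hull \<Rightarrow> 'a div_hull \<Rightarrow> bool"
  is "\<lambda>(a, m) (b, n). nmult n a \<le> nmult m b"
proof (clarsimp simp: hull_rel_def)
  fix a a' b b' :: 'a and m m' n n' :: nat
  assume pos: "0 < m" "0 < m'" "0 < n" "0 < n'"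
    and eq: "nmult m' a = nmult m a'" "nmult n' b = nmult n b'"
  have "nmult n a \<le> nmult m b \<longleftrightarrow> nmult (m' * n') (nmult n a) \<le> nmult (m' * n') (nmult m b)"
    using pos by (simp add: nmult_le_iff)
  also have "\<dots> \<longleftrightarrow> nmult (n * n') (nmult m' a) \<le> nmult (m * m') (nmult n' b)"
    by (simp add: nmult_nmult mult_ac)
  also have "\<dots> \<longleftrightarrow> nmult (m * n) (nmult n' a') \<le> nmult (m * n) (nmult m' b')"
    by (simp add: eq nmult_nmult mult_ac)
  also have "\<dots> \<longleftrightarrow> nmult n' a' \<le> nmult m' b'"
    using pos by (simp add: nmult_le_iff)
  finally show "nmult n a \<le> nmult m b \<longleftrightarrow> nmult n' a' \<le> nmult m' b'" .
qed

definition less_div_hull :: "'a div_hull \<Rightarrow> 'a div_hull \<Rightarrow> bool" where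
  "x < y \<longleftrightarrow> x \<le> y \<and> \<not> y \<le> (x :: 'a div_hull)"

lemma hull_zero: "0 = hfrac 0 1"
  by transfer (simp add: hull_rel_def)

lemma hfrac_add:
  "0 < m \<Longrightarrow> 0 < n \<Longrightarrow> hfrac a m + hfrac b n = hfrac (nmult n a + nmult m b) (m * n)"
  by transfer (simp add: hull_rel_def)

lemma hfrac_uminus: "0 < n \<Longrightarrow> - hfrac a n = hfrac (- a) n"
  by transfer (simp add: hull_rel_def)

lemma hfrac_le_iff:
  "0 < m \<Longrightarrow> 0 < n \<Longrightarrow> hfrac a m \<le> hfrac b n \<longleftrightarrow> nmult n a \<le> nmult m b"
  by transfer simp

instance
proof
  fix x y z :: "'a div_hull"
  obtain a l b m c n where pos: "0 < l" "0 < m" "0 < n"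
    and xyz: "x = hfrac a l" "y = hfrac b m" "z = hfrac c n"
    by (metis hull_cases)
  show "x + y + z = x + (y + z)"
    by (simp add: xyz pos hfrac_add nmult_plus nmult_nmult mult_ac add_ac)
  show comm: "x + y = y + x"
    by (simp add: xyz pos hfrac_add mult_ac add_ac)
  show "0 + x = x"
    by (simp add: xyz pos hfrac_add hull_zero)
  show "- x + x = 0"
    by (simp add: xyz pos hfrac_add hfrac_uminus hfrac_eq_iff hull_zero nmult_uminus)
  show "x - y = x + - y"
    by (rule minus_div_hull_def)
  show "x < y \<longleftrightarrow> x \<le> y \<and> \<not> y \<le> x"
    by (rule less_div_hull_def)
  show "x \<le> x"
    by (simp add: xyz pos hfrac_le_iff)
  show "x \<le> z" if "x \<le> y" "y \<le> z"
  proof -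
    have 1: "nmult m a \<le> nmult l b" and 2: "nmult n b \<le> nmult m c"
      using that by (simp_all add: xyz pos hfrac_le_iff)
    have "nmult m (nmult n a) \<le> nmult m (nmult l c)"
      using nmult_mono[OF 1, of n] nmult_mono[OF 2, of l]
      by (simp add: nmult_nmult mult_ac)
    then show ?thesis
      by (simp add: xyz pos hfrac_le_iff nmult_le_iff)
  qed
  show "x = y" if "x \<le> y" "y \<le> x"
    using that by (simp add: xyz pos hfrac_le_iff hfrac_eq_iff)
  show "x \<le> y \<or> y \<le> x"
    by (simp add: xyz pos hfrac_le_iff linear)
  show "z + x \<le> z + y" if "x \<le> y"
  proof -
    have 1: "nmult m a \<le> nmult l b"
      using that by (simp add: xyz pos hfrac_le_iff)
    show ?thesis
      using nmult_mono[OF 1, of "n * n"]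
      by (simp add: xyz pos hfrac_le_iff hfrac_add nmult_plus nmult_nmult mult_ac)
  qed
qed

end

text \<open>The divisible hull of a subgroup, inside that of the ambient group.\<close>

definition hull_of :: "'g::linordered_ab_group_add set \<Rightarrow> 'g div_hull set" where
  "hull_of \<Gamma> = {hfrac \<gamma> n |\<gamma> n. \<gamma> \<in> \<Gamma> \<and> 0 < n}"


section \<open>The ordered set of fractions of a totally ordered abelian monoid\<close>

definition mdiv_rel ::
  "'m::{ordered_comm_monoid_add, linorder} \<times> nat \<Rightarrow> 'm \<times> nat \<Rightarrow> bool" where
  "mdiv_rel = (\<lambda>(a, m) (b, n).
     0 < m \<and> 0 < n \<and> (\<exists>t>0. nmult (t * n) a = nmult (t * m) b))"

lemma part_equivp_mdiv_rel:
  "part_equivp (mdiv_rel :: 'a::{ordered_comm_monoid_add, linorder} \<times> nat \<Rightarrow> _)"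
proof (rule part_equivpI)
  show "\<exists>x. mdiv_rel x x"
    by (auto simp: mdiv_rel_def intro!: exI[of _ "Suc 0"])
  show "symp mdiv_rel"
    by (rule sympI) (clarsimp simp: mdiv_rel_def, metis)
  show "transp (mdiv_rel :: 'a \<times> nat \<Rightarrow> _)"
  proof (rule transpI)
    fix x y z :: "'a \<times> nat"
    assume xy: "mdiv_rel x y" and yz: "mdiv_rel y z"
    obtain a l b m c n where xyz: "x = (a, l)" "y = (b, m)" "z = (c, n)"
      by (metis surj_pair)
    obtain s t where eq: "nmult (s * m) a = nmult (s * l) b" "nmult (t * n) b = nmult (t * m) c"
      and pos: "0 < s" "0 < t" "0 < l" "0 < m" "0 < n"
      using xy yz by (auto simp: mdiv_rel_def xyz)
    have "nmult ((s * t * m) * n) a = nmult (t * n) (nmult (s * m) a)"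
      by (simp add: nmult_nmult mult_ac)
    also have "\<dots> = nmult (s * l) (nmult (t * n) b)"
      unfolding eq(1) by (simp add: nmult_nmult mult_ac)
    also have "\<dots> = nmult ((s * t * m) * l) c"
      unfolding eq(2) by (simp add: nmult_nmult mult_ac)
    finally have "\<exists>t>0. nmult (t * n) a = nmult (t * l) c"
      using pos by (intro exI[of _ "s * t * m"]) simp
    then show "mdiv_rel x z"
      by (simp add: mdiv_rel_def xyz pos)
  qed
qed

quotient_type (overloaded) 'm mdiv = "'m::{ordered_comm_monoid_add, linorder} \<times> nat" / partial: mdiv_rel
  by (rule part_equivp_mdiv_rel)

text \<open>\<open>mfrac a n\<close> is the element \<open>(a, n)\<close>; it is meaningful only for \<open>0 < n\<close>.\<close>

lift_definition mfrac :: "'m::{ordered_comm_monoid_add, linorder} \<Rightarrow> nat \<Rightarrow> 'm mdiv"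
  is "\<lambda>a n. if n = 0 then (0, 1) else (a, n)"
  by (auto simp: mdiv_rel_def)

lemma mfrac_eq_iff:
  "0 < m \<Longrightarrow> 0 < n \<Longrightarrow>
   mfrac a m = mfrac b n \<longleftrightarrow> (\<exists>t>0. nmult (t * n) a = nmult (t * m) b)"
  by transfer (simp add: mdiv_rel_def)

lemma mdiv_cases:
  obtains a n where "0 < n" "x = mfrac a n"
proof -
  have "\<exists>a n. 0 < n \<and> x = mfrac a n"
    by transfer (auto simp: mdiv_rel_def split: prod.splits)
  then show ?thesis
    using that by blast
qed

lemma mdiv_rel_le:
  fixes a a' b b' :: "'m::{ordered_comm_monoid_add, linorder}"
  assumes "mdiv_rel (a, m) (a', m')" "mdiv_rel (b, n) (b', n')"
    and "0 < t" "nmult (t * n) a \<le> nmult (t * m) b"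
  shows "\<exists>t>0. nmult (t * n') a' \<le> nmult (t * m') b'"
proof -
  obtain r s where pos: "0 < r" "0 < s" "0 < m" "0 < m'" "0 < n" "0 < n'"
    and eq: "nmult (r * m') a = nmult (r * m) a'" "nmult (s * n') b = nmult (s * n) b'"
    using assms(1,2) by (auto simp: mdiv_rel_def)
  have "nmult ((r * s * t * m * n) * n') a' = nmult (s * t * n * n') (nmult (r * m) a')"
    by (simp add: nmult_nmult mult_ac)
  also have "\<dots> = nmult (s * r * n' * m') (nmult (t * n) a)"
    unfolding eq(1)[symmetric] by (simp add: nmult_nmult mult_ac)
  also have "\<dots> \<le> nmult (s * r * n' * m') (nmult (t * m) b)"
    by (rule nmult_mono[OF assms(4)])
  also have "\<dots> = nmult (r * m' * t * m) (nmult (s * n') b)"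
    by (simp add: nmult_nmult mult_ac)
  also have "\<dots> = nmult ((r * s * t * m * n) * m') b'"
    unfolding eq(2) by (simp add: nmult_nmult mult_ac)
  finally show ?thesis
    using pos assms(3) by (intro exI[of _ "r * s * t * m * n"]) simp
qed

instantiation mdiv :: ("{ordered_comm_monoid_add, linorder}") linorder
begin

lift_definition less_eq_mdiv :: "'a mdiv \<Rightarrow> 'a mdiv \<Rightarrow> bool"
  is "\<lambda>(a, m) (b, n). \<exists>t>0. nmult (t * n) a \<le> nmult (t * m) b"
proof (clarify, rule iffI)
  fix a a' b b' :: 'a and m m' n n' :: nat
  assume rel: "mdiv_rel (a, m) (a', m')" "mdiv_rel (b, n) (b', n')"
  then have rel': "mdiv_rel (a', m') (a, m)" "mdiv_rel (b', n') (b, n)"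
    using part_equivp_symp[OF part_equivp_mdiv_rel] by blast+
  show "\<exists>t>0. nmult (t * n') a' \<le> nmult (t * m') b'"
    if "\<exists>t>0. nmult (t * n) a \<le> nmult (t * m) b"
    using mdiv_rel_le[OF rel] that by blast
  show "\<exists>t>0. nmult (t * n) a \<le> nmult (t * m) b"
    if "\<exists>t>0. nmult (t * n') a' \<le> nmult (t * m') b'"
    using mdiv_rel_le[OF rel'] that by blast
qed

definition less_mdiv :: "'a mdiv \<Rightarrow> 'a mdiv \<Rightarrow> bool" where
  "x < y \<longleftrightarrow> x \<le> y \<and> \<not> y \<le> (x :: 'a mdiv)"

lemma mfrac_le_iff:
  "0 < m \<Longrightarrow> 0 < n \<Longrightarrow>
   mfrac a m \<le> mfrac b n \<longleftrightarrow> (\<exists>t>0. nmult (t * n) a \<le> nmult (t * m) b)"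
  by transfer simp

instance
proof
  fix x y z :: "'a mdiv"
  obtain a l b m c n where pos: "0 < l" "0 < m" "0 < n"
    and xyz: "x = mfrac a l" "y = mfrac b m" "z = mfrac c n"
    by (metis mdiv_cases)
  show "x < y \<longleftrightarrow> x \<le> y \<and> \<not> y \<le> x"
    by (rule less_mdiv_def)
  show "x \<le> x"
    by (auto simp: xyz pos mfrac_le_iff)
  show "x \<le> z" if xy: "x \<le> y" and yz: "y \<le> z"
  proof -
    obtain s t where st: "0 < s" "0 < t"
      and 1: "nmult (s * m) a \<le> nmult (s * l) b" and 2: "nmult (t * n) b \<le> nmult (t * m) c"
      using xy yz unfolding xyz mfrac_le_iff[OF pos(1,2)] mfrac_le_iff[OF pos(2,3)] by blast
    have "nmult ((s * t * m) * n) a \<le> nmult ((s * t * m) * l) c"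
      using nmult_mono[OF 1, of "t * n"] nmult_mono[OF 2, of "s * l"]
      by (simp add: nmult_nmult mult_ac)
    then have "\<exists>t>0. nmult (t * n) a \<le> nmult (t * l) c"
      using st pos by (intro exI[of _ "s * t * m"]) simp
    then show ?thesis
      by (simp add: xyz pos mfrac_le_iff)
  qed
  show "x = y" if xy: "x \<le> y" and yx: "y \<le> x"
  proof -
    obtain s t where st: "0 < s" "0 < t"
      and 1: "nmult (s * m) a \<le> nmult (s * l) b" and 2: "nmult (t * l) b \<le> nmult (t * m) a"
      using xy yx unfolding xyz mfrac_le_iff[OF pos(1,2)] mfrac_le_iff[OF pos(2,1)] by blast
    have "nmult ((s * t) * m) a = nmult ((s * t) * l) b"
      using nmult_mono[OF 1, of t] nmult_mono[OF 2, of s]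
      by (simp add: nmult_nmult mult_ac)
    then have "\<exists>t>0. nmult (t * m) a = nmult (t * l) b"
      using st by (intro exI[of _ "s * t"]) simp
    then show ?thesis
      by (simp add: xyz pos mfrac_eq_iff)
  qed
  show "x \<le> y \<or> y \<le> x"
    unfolding xyz mfrac_le_iff[OF pos(1,2)] mfrac_le_iff[OF pos(2,1)]
    by (metis linear zero_less_one)
qed

end


section \<open>Field extensions, valuations and quasi-valuations\<close>

text \<open>The field extension is given by the embedding \<open>i\<close> of the base field.\<close>

definition field_embedding :: "('f::field \<Rightarrow> 'e::field) \<Rightarrow> bool" where
  "field_embedding i \<longleftrightarrow>
     i 1 = 1 \<and> (\<forall>a b. i (a + b) = i a + i b) \<and> (\<forall>a b. i (a * b) = i a * i b)"

definition finite_extension :: "('f::field \<Rightarrow> 'e::field) \<Rightarrow> bool" where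
  "finite_extension i \<longleftrightarrow>
     field_embedding i \<and> (\<exists>B. finite_dimensional_vector_space (\<lambda>a x. i a * x) B)"

definition valuation :: "('k::field \<Rightarrow> 'g::linordered_ab_group_add with_inf) \<Rightarrow> bool" where
  "valuation v \<longleftrightarrow>
     (\<forall>x. v x = Infty \<longleftrightarrow> x = 0) \<and>
     (\<forall>x y. v (x * y) = v x + v y) \<and>
     (\<forall>x y. min (v x) (v y) \<le> v (x + y))"

definition value_group :: "('k::field \<Rightarrow> 'g with_inf) \<Rightarrow> 'g set" where
  "value_group v = {\<gamma>. \<exists>x. x \<noteq> 0 \<and> v x = Fin \<gamma>}"

definition quasi_valuation ::
  "('a::ring \<Rightarrow> 'm::{ordered_comm_monoid_add, linorder} with_inf) \<Rightarrow> bool" where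
  "quasi_valuation w \<longleftrightarrow>
     w 0 = Infty \<and>
     (\<forall>x y. w x + w y \<le> w (x * y)) \<and>
     (\<forall>x y. min (w x) (w y) \<le> w (x + y))"

text \<open>\<open>j\<close> identifies the subset \<open>\<Gamma>\<close> of \<open>'g\<close> with an ordered submonoid of \<open>'m\<close>;
  its values outside \<open>\<Gamma>\<close> are irrelevant.\<close>

definition ordered_submonoid_embedding ::
  "'g::linordered_ab_group_add set \<Rightarrow> ('g \<Rightarrow> 'm::{ordered_comm_monoid_add, linorder}) \<Rightarrow> bool" where
  "ordered_submonoid_embedding \<Gamma> j \<longleftrightarrow>
     j 0 = 0 \<and>
     (\<forall>a\<in>\<Gamma>. \<forall>b\<in>\<Gamma>. j (a + b) = j a + j b) \<and>
     (\<forall>a\<in>\<Gamma>. \<forall>b\<in>\<Gamma>. j a \<le> j b \<longleftrightarrow> a \<le> b)"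

definition quasi_valuation_extends ::
  "('f::field \<Rightarrow> 'e::field) \<Rightarrow> ('g::linordered_ab_group_add \<Rightarrow> 'm) \<Rightarrow>
   ('e \<Rightarrow> 'm::{ordered_comm_monoid_add, linorder} with_inf) \<Rightarrow> ('f \<Rightarrow> 'g with_inf) \<Rightarrow> bool" where
  "quasi_valuation_extends i j w v \<longleftrightarrow>
     ordered_submonoid_embedding (value_group v) j \<and>
     (\<forall>a. w (i a) = map_with_inf j (v a))"

text \<open>A valuation extending \<open>v\<close> takes its values in the divisible hull of the value group of
  \<open>v\<close>, which contains the value group through \<open>\<gamma> \<mapsto> (\<gamma>, 1)\<close>.\<close>

definition valuation_extends ::
  "('f::field \<Rightarrow> 'e::field) \<Rightarrow> ('e \<Rightarrow> 'g::linordered_ab_group_add div_hull with_inf) \<Rightarrow>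
   ('f \<Rightarrow> 'g with_inf) \<Rightarrow> bool" where
  "valuation_extends i u v \<longleftrightarrow>
     value_group u \<subseteq> hull_of (value_group v) \<and>
     (\<forall>a. u (i a) = map_with_inf (\<lambda>\<gamma>. hfrac \<gamma> 1) (v a))"

text \<open>\<open>O\<^sub>w\<close> and \<open>I\<^sub>w\<close>; for a valuation, its valuation ring and valuation ideal.\<close>

definition nonneg_set :: "('a \<Rightarrow> 'm::{zero, ord}) \<Rightarrow> 'a set" where
  "nonneg_set w = {x. 0 \<le> w x}"

definition pos_set :: "('a \<Rightarrow> 'm::{zero, ord}) \<Rightarrow> 'a set" where
  "pos_set w = {x. 0 < w x}"

inductive_set submonoid_generated :: "'m::comm_monoid_add set \<Rightarrow> 'm set" for S where
  zero: "0 \<in> submonoid_generated S"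
| incl: "a \<in> S \<Longrightarrow> a \<in> submonoid_generated S"
| add: "a \<in> submonoid_generated S \<Longrightarrow> b \<in> submonoid_generated S \<Longrightarrow>
        a + b \<in> submonoid_generated S"

definition value_monoid :: "('e::field \<Rightarrow> 'm::comm_monoid_add with_inf) \<Rightarrow> 'm set" where
  "value_monoid w = submonoid_generated {m. \<exists>x. x \<noteq> 0 \<and> w x = Fin m}"


section \<open>The common ordered set of values\<close>

text \<open>\<open>\<Gamma>\<close> is a group with embedding \<open>j\<close> into the monoid \<open>M\<close>. The set of fractions of \<open>M\<close> is
  taken inside that of the whole type, with the same equality and order.\<close>

definition T_set :: "'g::linordered_ab_group_add set \<Rightarrow> 'm set \<Rightarrow> ('m + 'g div_hull) set" where
  "T_set \<Gamma> M = M <+> hull_of \<Gamma>"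

text \<open>The description in the second case does not depend on the representative \<open>(\<gamma>, n)\<close> with
  \<open>\<gamma> \<in> \<Gamma>\<close>; see \<open>phi_hfrac\<close> below.\<close>

definition phi :: "'g::linordered_ab_group_add set \<Rightarrow>
    ('g \<Rightarrow> 'm::{ordered_comm_monoid_add, linorder}) \<Rightarrow> 'm + 'g div_hull \<Rightarrow> 'm mdiv" where
  "phi \<Gamma> j t = (case t of
     Inl m \<Rightarrow> mfrac m 1
   | Inr q \<Rightarrow> (THE p. \<exists>\<gamma>\<in>\<Gamma>. \<exists>n>0. q = hfrac \<gamma> n \<and> p = mfrac (j \<gamma>) n))"

definition T_rel :: "'g::linordered_ab_group_add set \<Rightarrow>
    ('g \<Rightarrow> 'm::{ordered_comm_monoid_add, linorder}) \<Rightarrow> 'm set \<Rightarrow>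
    (('m + 'g div_hull) \<times> ('m + 'g div_hull)) set" where
  "T_rel \<Gamma> j M = {(x, y). x \<in> T_set \<Gamma> M \<and> y \<in> T_set \<Gamma> M \<and>
     (if isl x \<and> isl y then x = y else phi \<Gamma> j x = phi \<Gamma> j y)}"

definition singular :: "'g::linordered_ab_group_add set \<Rightarrow>
    ('g \<Rightarrow> 'm::{ordered_comm_monoid_add, linorder}) \<Rightarrow> 'm set \<Rightarrow> 'm + 'g div_hull \<Rightarrow> bool" where
  "singular \<Gamma> j M x \<longleftrightarrow> x \<in> Inl ` M \<and> (\<forall>y. (x, y) \<in> T_rel \<Gamma> j M \<longrightarrow> x = y)"

definition T_class :: "'g::linordered_ab_group_add set \<Rightarrow>
    ('g \<Rightarrow> 'm::{ordered_comm_monoid_add, linorder}) \<Rightarrow> 'm set \<Rightarrow>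
    'm + 'g div_hull \<Rightarrow> ('m + 'g div_hull) set" where
  "T_class \<Gamma> j M x = T_rel \<Gamma> j M `` {x}"

text \<open>The order on the quotient; by \<open>T_le_class_iff\<close> below it does not depend on the
  representatives.\<close>

definition T_le :: "'g::linordered_ab_group_add set \<Rightarrow>
    ('g \<Rightarrow> 'm::{ordered_comm_monoid_add, linorder}) \<Rightarrow> 'm set \<Rightarrow>
    ('m + 'g div_hull) set \<Rightarrow> ('m + 'g div_hull) set \<Rightarrow> bool" where
  "T_le \<Gamma> j M X Y \<longleftrightarrow>
     (\<exists>x\<in>T_set \<Gamma> M. \<exists>y\<in>T_set \<Gamma> M. X = T_class \<Gamma> j M x \<and> Y = T_class \<Gamma> j M y \<and>
        (if singular \<Gamma> j M x \<and> singular \<Gamma> j M y then projl x \<le> projl y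
         else phi \<Gamma> j x \<le> phi \<Gamma> j y))"

fun le_with_inf :: "('t \<Rightarrow> 't \<Rightarrow> bool) \<Rightarrow> 't with_inf \<Rightarrow> 't with_inf \<Rightarrow> bool" where
  "le_with_inf le (Fin X) (Fin Y) \<longleftrightarrow> le X Y"
| "le_with_inf le Infty (Fin Y) \<longleftrightarrow> False"
| "le_with_inf le X Infty \<longleftrightarrow> True"

definition dominates ::
  "('f::field \<Rightarrow> 'g::linordered_ab_group_add with_inf) \<Rightarrow>
   ('g \<Rightarrow> 'm::{ordered_comm_monoid_add, linorder}) \<Rightarrow>
   ('e::field \<Rightarrow> 'm with_inf) \<Rightarrow> ('e \<Rightarrow> 'g div_hull with_inf) \<Rightarrow> bool" where
  "dominates v j w u \<longleftrightarrow>
     (let \<Gamma> = value_group v; M = value_monoid w in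
      \<forall>x. le_with_inf (T_le \<Gamma> j M)
            (map_with_inf (\<lambda>m. T_class \<Gamma> j M (Inl m)) (w x))
            (map_with_inf (\<lambda>q. T_class \<Gamma> j M (Inr q)) (u x)))"


subsection \<open>Well-definedness\<close>

locale value_setting =
  fixes \<Gamma> :: "'g::linordered_ab_group_add set"
    and j :: "'g \<Rightarrow> 'm::{ordered_comm_monoid_add, linorder}"
    and M :: "'m set"
  assumes zero_mem: "0 \<in> \<Gamma>"
    and add_mem: "a \<in> \<Gamma> \<Longrightarrow> b \<in> \<Gamma> \<Longrightarrow> a + b \<in> \<Gamma>"
    and uminus_mem: "a \<in> \<Gamma> \<Longrightarrow> - a \<in> \<Gamma>"
    and emb: "ordered_submonoid_embedding \<Gamma> j"
begin

lemma j_add: "a \<in> \<Gamma> \<Longrightarrow> b \<in> \<Gamma> \<Longrightarrow> j (a + b) = j a + j b"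
  and j_zero: "j 0 = 0"
  and j_le_iff: "a \<in> \<Gamma> \<Longrightarrow> b \<in> \<Gamma> \<Longrightarrow> j a \<le> j b \<longleftrightarrow> a \<le> b"
  using emb by (auto simp: ordered_submonoid_embedding_def)

lemma nmult_mem: "a \<in> \<Gamma> \<Longrightarrow> nmult n a \<in> \<Gamma>"
  by (induction n) (auto simp: zero_mem add_mem)

lemma j_nmult: "a \<in> \<Gamma> \<Longrightarrow> j (nmult n a) = nmult n (j a)"
  by (induction n) (auto simp: j_zero j_add nmult_mem)

lemma phi_hfrac:
  assumes "\<gamma> \<in> \<Gamma>" "0 < n"
  shows "phi \<Gamma> j (Inr (hfrac \<gamma> n)) = mfrac (j \<gamma>) n"
proof -
  have "mfrac (j \<delta>) k = mfrac (j \<gamma>) n" if "\<delta> \<in> \<Gamma>" "0 < k" "hfrac \<gamma> n = hfrac \<delta> k" for \<delta> k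
  proof -
    have "nmult k \<gamma> = nmult n \<delta>"
      using that assms by (simp add: hfrac_eq_iff)
    then have "nmult k (j \<gamma>) = nmult n (j \<delta>)"
      using that assms by (metis j_nmult)
    then show ?thesis
      using that assms by (auto simp: mfrac_eq_iff intro!: exI[of _ "Suc 0"])
  qed
  then have "(THE p. \<exists>\<delta>\<in>\<Gamma>. \<exists>k>0. hfrac \<gamma> n = hfrac \<delta> k \<and> p = mfrac (j \<delta>) k) = mfrac (j \<gamma>) n"
    using assms by (intro the_equality) blast+
  then show ?thesis
    by (simp add: phi_def)
qed

lemma phi_Inl: "phi \<Gamma> j (Inl m) = mfrac m 1"
  by (simp add: phi_def)

text \<open>Two elements of the monoid that are related to the same element of the hull are equal.\<close>

lemma monoid_hull_unique:
  assumes q: "q \<in> hull_of \<Gamma>"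
    and x: "phi \<Gamma> j (Inl x) = phi \<Gamma> j (Inr q)" and y: "phi \<Gamma> j (Inl y) = phi \<Gamma> j (Inr q)"
  shows "x = y"
proof -
  have *: "x = y" if xy: "x \<le> y" and g: "\<gamma> \<in> \<Gamma>" "nmult (Suc k) x = j \<gamma>" "nmult (Suc k) y = j \<gamma>"
    for x y :: 'm and \<gamma> k
  proof -
    have inv: "j \<gamma> + j (- \<gamma>) = 0"
      using j_add[OF g(1) uminus_mem[OF g(1)]] by (simp add: j_zero)
    define z where "z = nmult k x + j (- \<gamma>)"
    have xz: "x + z = 0"
      using g(2) inv by (simp add: z_def add.assoc[symmetric])
    have "nmult k x + y \<le> nmult k y + y"
      by (intro add_right_mono nmult_mono xy)
    also have "\<dots> = j \<gamma>"
      using g(3) by (simp add: add.commute)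
    finally have "z + y \<le> 0"
      using add_right_mono[of "nmult k x + y" "j \<gamma>" "j (- \<gamma>)"] inv by (simp add: z_def add_ac)
    then have "x + (z + y) \<le> x + 0"
      by (rule add_left_mono)
    then have "y \<le> x"
      using xz by (simp add: add.assoc[symmetric])
    with xy show ?thesis
      by simp
  qed
  obtain \<gamma> n where g: "\<gamma> \<in> \<Gamma>" "0 < n" "q = hfrac \<gamma> n"
    using q by (auto simp: hull_of_def)
  obtain s where s: "0 < s" "nmult (s * n) x = nmult s (j \<gamma>)"
    using x g by (auto simp: phi_hfrac phi_Inl mfrac_eq_iff)
  obtain t where t: "0 < t" "nmult (t * n) y = nmult t (j \<gamma>)"
    using y g by (auto simp: phi_hfrac phi_Inl mfrac_eq_iff)
  obtain k where k: "s * t * n = Suc k"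
    using s t g by (metis gr0_conv_Suc nat_0_less_mult_iff)
  have "nmult (s * t * n) x = j (nmult (s * t) \<gamma>)"
    using arg_cong[OF s(2), of "nmult t"] g by (simp add: j_nmult nmult_nmult mult_ac)
  moreover have "nmult (s * t * n) y = j (nmult (s * t) \<gamma>)"
    using arg_cong[OF t(2), of "nmult s"] g by (simp add: j_nmult nmult_nmult mult_ac)
  ultimately show ?thesis
    unfolding k using * nmult_mem[OF g(1)] by (metis linear)
qed

lemma T_relD: "(x, y) \<in> T_rel \<Gamma> j M \<Longrightarrow> phi \<Gamma> j x = phi \<Gamma> j y"
  by (auto simp: T_rel_def split: if_splits)

lemma equiv_T_rel: "equiv (T_set \<Gamma> M) (T_rel \<Gamma> j M)"
proof (rule equivI)
  show "T_rel \<Gamma> j M \<subseteq> T_set \<Gamma> M \<times> T_set \<Gamma> M"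
    by (auto simp: T_rel_def)
  show "refl_on (T_set \<Gamma> M) (T_rel \<Gamma> j M)"
    by (auto simp: refl_on_def T_rel_def)
  show "sym (T_rel \<Gamma> j M)"
    by (auto simp: sym_def T_rel_def split: if_splits)
  show "trans (T_rel \<Gamma> j M)"
  proof (rule transI)
    fix x y z
    assume xy: "(x, y) \<in> T_rel \<Gamma> j M" and yz: "(y, z) \<in> T_rel \<Gamma> j M"
    have phi: "phi \<Gamma> j x = phi \<Gamma> j y" "phi \<Gamma> j y = phi \<Gamma> j z"
      using xy yz by (simp_all add: T_relD)
    have "x = z" if "isl x" "isl z"
    proof (cases "isl y")
      case True
      then show ?thesis
        using xy yz that by (auto simp: T_rel_def)
    next
      case False
      then obtain q where q: "y = Inr q"
        by (cases y) auto
      then have "q \<in> hull_of \<Gamma>"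
        using xy by (auto simp: T_rel_def T_set_def)
      then show ?thesis
        using that phi q by (auto simp: isl_def intro: monoid_hull_unique)
    qed
    then show "(x, z) \<in> T_rel \<Gamma> j M"
      using xy yz phi by (auto simp: T_rel_def)
  qed
qed

lemma T_le_class_iff:
  assumes "x \<in> T_set \<Gamma> M" "y \<in> T_set \<Gamma> M"
  shows "T_le \<Gamma> j M (T_class \<Gamma> j M x) (T_class \<Gamma> j M y) \<longleftrightarrow>
     (if singular \<Gamma> j M x \<and> singular \<Gamma> j M y then projl x \<le> projl y
      else phi \<Gamma> j x \<le> phi \<Gamma> j y)"
proof -
  have eq: "T_class \<Gamma> j M a = T_class \<Gamma> j M b \<longleftrightarrow> (a, b) \<in> T_rel \<Gamma> j M"
    if "a \<in> T_set \<Gamma> M" "b \<in> T_set \<Gamma> M" for a b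
    unfolding T_class_def using eq_equiv_class_iff[OF equiv_T_rel that] .
  have sing: "a = b" if "(a, b) \<in> T_rel \<Gamma> j M" "singular \<Gamma> j M a \<or> singular \<Gamma> j M b" for a b
    using that equiv_T_rel unfolding singular_def equiv_def by (metis symD)
  show ?thesis (is "_ \<longleftrightarrow> ?R x y")
  proof
    assume "T_le \<Gamma> j M (T_class \<Gamma> j M x) (T_class \<Gamma> j M y)"
    then obtain a b where ab: "(x, a) \<in> T_rel \<Gamma> j M" "(y, b) \<in> T_rel \<Gamma> j M" "?R a b"
      using assms by (auto simp: T_le_def eq)
    then have "phi \<Gamma> j x = phi \<Gamma> j a" "phi \<Gamma> j y = phi \<Gamma> j b"
      by (simp_all add: T_relD)
    moreover have "singular \<Gamma> j M x \<longleftrightarrow> singular \<Gamma> j M a" "singular \<Gamma> j M y \<longleftrightarrow> singular \<Gamma> j M b"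
      using sing ab(1,2) by blast+
    ultimately show "?R x y"
      using ab sing by metis
  next
    assume "?R x y"
    then show "T_le \<Gamma> j M (T_class \<Gamma> j M x) (T_class \<Gamma> j M y)"
      unfolding T_le_def using assms by blast
  qed
qed

lemma T_le_linear_order:
  "linear_order_on (T_set \<Gamma> M // T_rel \<Gamma> j M)
     {(X, Y). X \<in> T_set \<Gamma> M // T_rel \<Gamma> j M \<and> Y \<in> T_set \<Gamma> M // T_rel \<Gamma> j M \<and> T_le \<Gamma> j M X Y}"
proof -
  let ?T = "T_set \<Gamma> M" and ?c = "T_class \<Gamma> j M" and ?s = "singular \<Gamma> j M"
  have Q: "X \<in> ?T // T_rel \<Gamma> j M \<longleftrightarrow> (\<exists>x\<in>?T. X = ?c x)" for X
    by (auto simp: quotient_def T_class_def)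
  have eq: "?c a = ?c b \<longleftrightarrow> (a, b) \<in> T_rel \<Gamma> j M" if "a \<in> ?T" "b \<in> ?T" for a b
    unfolding T_class_def using eq_equiv_class_iff[OF equiv_T_rel that] .
  have phi_mono: "phi \<Gamma> j x \<le> phi \<Gamma> j y" if "T_le \<Gamma> j M (?c x) (?c y)" "x \<in> ?T" "y \<in> ?T" for x y
    using that by (auto simp: T_le_class_iff singular_def phi_Inl mfrac_le_iff nmult_mono
        intro!: exI[of _ "Suc 0"] split: if_splits)
  have key: "x = y" if "?s x" "phi \<Gamma> j x = phi \<Gamma> j y" "y \<in> ?T" and ns: "\<not> ?s y" for x y
  proof (cases "isl y")
    case False
    then have "(x, y) \<in> T_rel \<Gamma> j M"
      using that by (auto simp: T_rel_def singular_def T_set_def)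
    then show ?thesis
      using that by (auto simp: singular_def)
  next
    case True
    then have "y \<in> Inl ` M"
      using that by (auto simp: T_set_def)
    then obtain z where z: "(y, z) \<in> T_rel \<Gamma> j M" "y \<noteq> z"
      using ns unfolding singular_def by blast
    then have "\<not> isl z"
      using True by (auto simp: T_rel_def)
    then have "(x, z) \<in> T_rel \<Gamma> j M"
      using that z T_relD[OF z(1)] by (auto simp: T_rel_def singular_def T_set_def)
    then have "x = z"
      using that by (auto simp: singular_def)
    then show ?thesis
      using that \<open>\<not> isl z\<close> by (auto simp: singular_def)
  qed
  have total: "T_le \<Gamma> j M (?c x) (?c y) \<or> T_le \<Gamma> j M (?c y) (?c x)" if "x \<in> ?T" "y \<in> ?T" for x y
    by (cases "?s x \<and> ?s y") (auto simp: T_le_class_iff that linear)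
  show ?thesis
    unfolding linear_order_on_def partial_order_on_def preorder_on_def
  proof (intro conjI)
    show "refl_on (?T // T_rel \<Gamma> j M) {(X, Y). X \<in> ?T // T_rel \<Gamma> j M \<and>
        Y \<in> ?T // T_rel \<Gamma> j M \<and> T_le \<Gamma> j M X Y}"
      by (auto simp: refl_on_def Q T_le_class_iff)
    show "total_on (?T // T_rel \<Gamma> j M) {(X, Y). X \<in> ?T // T_rel \<Gamma> j M \<and>
        Y \<in> ?T // T_rel \<Gamma> j M \<and> T_le \<Gamma> j M X Y}"
    proof (unfold total_on_def, intro ballI impI)
      fix X Y
      assume XY: "X \<in> ?T // T_rel \<Gamma> j M" "Y \<in> ?T // T_rel \<Gamma> j M"
      then have "T_le \<Gamma> j M X Y \<or> T_le \<Gamma> j M Y X"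
        unfolding Q using total by blast
      then show "(X, Y) \<in> {(X, Y). X \<in> ?T // T_rel \<Gamma> j M \<and> Y \<in> ?T // T_rel \<Gamma> j M \<and> T_le \<Gamma> j M X Y} \<or>
          (Y, X) \<in> {(X, Y). X \<in> ?T // T_rel \<Gamma> j M \<and> Y \<in> ?T // T_rel \<Gamma> j M \<and> T_le \<Gamma> j M X Y}"
        using XY by blast
    qed
    show "antisym {(X, Y). X \<in> ?T // T_rel \<Gamma> j M \<and> Y \<in> ?T // T_rel \<Gamma> j M \<and> T_le \<Gamma> j M X Y}"
    proof (rule antisymI)
      fix X Y
      assume "(X, Y) \<in> {(X, Y). X \<in> ?T // T_rel \<Gamma> j M \<and> Y \<in> ?T // T_rel \<Gamma> j M \<and> T_le \<Gamma> j M X Y}"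
        and "(Y, X) \<in> {(X, Y). X \<in> ?T // T_rel \<Gamma> j M \<and> Y \<in> ?T // T_rel \<Gamma> j M \<and> T_le \<Gamma> j M X Y}"
      then have le: "X \<in> ?T // T_rel \<Gamma> j M" "Y \<in> ?T // T_rel \<Gamma> j M" "T_le \<Gamma> j M X Y" "T_le \<Gamma> j M Y X"
        by simp_all
      from le(1,2) obtain x y where XY: "X = ?c x" "Y = ?c y" and T: "x \<in> ?T" "y \<in> ?T"
        unfolding Q by (elim bexE)
      note xy = T le(3,4)[unfolded XY]
      from xy have phi: "phi \<Gamma> j x = phi \<Gamma> j y"
        by (intro order_antisym phi_mono)
      have "?c x = ?c y"
      proof (cases "?s x \<or> ?s y")
        case True
        show ?thesis
        proof (cases "?s x \<and> ?s y")
          case True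
          then show ?thesis
            using xy by (auto simp: T_le_class_iff singular_def)
        next
          case False
          then show ?thesis
            using True key phi xy by metis
        qed
      next
        case False
        have hull: "\<exists>z. (x, z) \<in> T_rel \<Gamma> j M \<and> \<not> isl z" if xT: "x \<in> ?T" and ns: "\<not> ?s x" for x
        proof (cases "isl x")
          case True
          then have "x \<in> Inl ` M"
            using xT by (auto simp: T_set_def)
          then obtain y where y: "(x, y) \<in> T_rel \<Gamma> j M" "x \<noteq> y"
            using ns unfolding singular_def by blast
          then have "\<not> isl y"
            using True by (auto simp: T_rel_def)
          then show ?thesis
            using y by blast
        next
          case False
          then show ?thesis
            using xT by (auto simp: T_rel_def)
        qed
        obtain z z' where z: "(x, z) \<in> T_rel \<Gamma> j M" "\<not> isl z" "(y, z') \<in> T_rel \<Gamma> j M" "\<not> isl z'"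
          using hull[of x] hull[of y] xy False by blast
        then have "(x, z') \<in> T_rel \<Gamma> j M"
          using phi T_relD[OF z(3)] z(1,3,4) by (auto simp: T_rel_def)
        moreover have "(z', y) \<in> T_rel \<Gamma> j M"
          using z(3) equiv_T_rel unfolding equiv_def by (blast dest: symD)
        ultimately have "(x, y) \<in> T_rel \<Gamma> j M"
          using equiv_T_rel unfolding equiv_def by (blast dest: transD)
        then show ?thesis
          using xy by (simp add: eq)
      qed
      then show "X = Y"
        by (simp add: XY)
    qed
    show "trans {(X, Y). X \<in> ?T // T_rel \<Gamma> j M \<and> Y \<in> ?T // T_rel \<Gamma> j M \<and> T_le \<Gamma> j M X Y}"
    proof (rule transI)
      fix X Y Z
      assume "(X, Y) \<in> {(X, Y). X \<in> ?T // T_rel \<Gamma> j M \<and> Y \<in> ?T // T_rel \<Gamma> j M \<and> T_le \<Gamma> j M X Y}"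
        and "(Y, Z) \<in> {(X, Y). X \<in> ?T // T_rel \<Gamma> j M \<and> Y \<in> ?T // T_rel \<Gamma> j M \<and> T_le \<Gamma> j M X Y}"
      then have le: "X \<in> ?T // T_rel \<Gamma> j M" "Y \<in> ?T // T_rel \<Gamma> j M" "Z \<in> ?T // T_rel \<Gamma> j M"
        "T_le \<Gamma> j M X Y" "T_le \<Gamma> j M Y Z"
        by simp_all
      from le(1-3) obtain x y z where XYZ: "X = ?c x" "Y = ?c y" "Z = ?c z"
        and T: "x \<in> ?T" "y \<in> ?T" "z \<in> ?T"
        unfolding Q by (elim bexE)
      note xyz = T le(4,5)[unfolded XYZ]
      have phi: "phi \<Gamma> j x \<le> phi \<Gamma> j y" "phi \<Gamma> j y \<le> phi \<Gamma> j z"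
        using xyz by (simp_all add: phi_mono)
      have "T_le \<Gamma> j M (?c x) (?c z)"
      proof (rule ccontr)
        assume neg: "\<not> T_le \<Gamma> j M (?c x) (?c z)"
        with xyz phi have s: "?s x" "?s z" and less: "\<not> projl x \<le> projl z"
          by (auto simp: T_le_class_iff split: if_splits)
        then have "T_le \<Gamma> j M (?c z) (?c x)"
          using xyz by (simp add: T_le_class_iff)
        then have "phi \<Gamma> j x = phi \<Gamma> j y"
          using phi xyz phi_mono[of z x] by force
        then have "?s y"
          using key s xyz by metis
        then show False
          using s less xyz by (auto simp: T_le_class_iff)
      qed
      then show "(X, Z) \<in> {(X, Y). X \<in> ?T // T_rel \<Gamma> j M \<and> Y \<in> ?T // T_rel \<Gamma> j M \<and> T_le \<Gamma> j M X Y}"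
        using le by (simp add: XYZ)
    qed
    show "{(X, Y). X \<in> ?T // T_rel \<Gamma> j M \<and> Y \<in> ?T // T_rel \<Gamma> j M \<and> T_le \<Gamma> j M X Y}
        \<subseteq> (?T // T_rel \<Gamma> j M) \<times> (?T // T_rel \<Gamma> j M)"
      by auto
  qed
qed

end

lemma value_setting_value_group:
  assumes v: "valuation v" and ext: "quasi_valuation_extends i j w v"
  shows "value_setting (value_group v) j"
proof
  have inf: "v x = Infty \<longleftrightarrow> x = 0" and mult: "v (x * y) = v x + v y" for x y
    using v by (auto simp: valuation_def)
  have one: "v 1 = Fin 0"
    using mult[of 1 1] inf[of 1] by (cases "v 1") simp_all
  show "0 \<in> value_group v"
    using one by (auto simp: value_group_def intro!: exI[of _ 1])
  show "a + b \<in> value_group v" if ab: "a \<in> value_group v" "b \<in> value_group v" for a b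
  proof -
    obtain x y where xy: "x \<noteq> 0" "v x = Fin a" "y \<noteq> 0" "v y = Fin b"
      using ab by (auto simp: value_group_def)
    then have "x * y \<noteq> 0" "v (x * y) = Fin (a + b)"
      by (simp_all add: mult)
    then show ?thesis
      unfolding value_group_def by blast
  qed
  show "- a \<in> value_group v" if a: "a \<in> value_group v" for a
  proof -
    obtain x where x: "x \<noteq> 0" "v x = Fin a"
      using a by (auto simp: value_group_def)
    then have "Fin a + v (inverse x) = Fin 0"
      using mult[of x "inverse x"] one by simp
    then have "v (inverse x) = Fin (- a)"
      by (cases "v (inverse x)") (simp_all add: eq_neg_iff_add_eq_0 add.commute)
    moreover have "inverse x \<noteq> 0"
      using x by simp
    ultimately show ?thesis
      unfolding value_group_def by blast
  qed
  show "ordered_submonoid_embedding (value_group v) j"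
    using ext by (simp add: quasi_valuation_extends_def)
qed

end

(* Write O and I for the elements of nonnegative and of positive w-value. A subset of E that is
   maximal among those containing I, closed under differences, products and multiplication by O, and
   not containing 1 has as idealizer a valuation ring R, which contains O; elements of I are
   nonunits of R. As I contains the maximal ideal of v, R lies over the valuation ring of v. Since
   E/F is algebraic, every nonzero x has a power x^n = c e with c in F and e a unit of R, and
   u(x) = (v(c), n) is the valuation of R. If n w(x) > v(c), then e = x^n / c lies in I, which is
   impossible for a unit; hence n w(x) <= v(c), that is, w(x) <= u(x). *)

theory Submission
  imports Defs "HOL-Computational_Algebra.Polynomial"
begin

section \<open>Chevalley's extension theorem\<close>

text \<open>Both \<open>0\<close> and \<open>1\<close> belong to \<open>R\<close> by the second
  clause, since each is its own inverse (\<open>inverse 0 = 0\<close>); closure under differences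
  and products then makes \<open>R\<close> a subring.\<close>

definition valuation_ring :: "'a::field set \<Rightarrow> bool" where
  "valuation_ring R \<longleftrightarrow>
     (\<forall>x\<in>R. \<forall>y\<in>R. x - y \<in> R \<and> x * y \<in> R) \<and> (\<forall>x. x \<in> R \<or> inverse x \<in> R)"

text \<open>\<open>I\<close> behaves like a proper ideal but need not lie inside \<open>A\<close>.
  So \<open>A\<close> stays fixed while \<open>I\<close> grows under Zorn's lemma, in place of the
  usual pairs of a ring and a prime ideal ordered by domination.\<close>

definition proper_stable :: "'a::field set \<Rightarrow> 'a set \<Rightarrow> bool" where
  "proper_stable A I \<longleftrightarrow> 0 \<in> I \<and> 1 \<notin> I \<and> (\<forall>a\<in>I. \<forall>b\<in>I. a - b \<in> I \<and> a * b \<in> I) \<and>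
     (\<forall>r\<in>A. \<forall>a\<in>I. r * a \<in> I)"

lemma diff_closed_uminus:
  "0 \<in> I \<Longrightarrow> \<forall>a\<in>I. \<forall>b\<in>I. a - b \<in> I \<Longrightarrow> a \<in> I \<Longrightarrow> - a \<in> (I :: 'a::ab_group_add set)"
  by (metis diff_0)

lemma diff_closed_add:
  "0 \<in> I \<Longrightarrow> \<forall>a\<in>I. \<forall>b\<in>I. a - b \<in> I \<Longrightarrow> a \<in> I \<Longrightarrow> b \<in> I \<Longrightarrow>
   a + b \<in> (I :: 'a::ab_group_add set)"
  by (metis diff_closed_uminus diff_minus_eq_add)

lemma diff_closed_sum:
  fixes I :: "'a::ab_group_add set"
  assumes "0 \<in> I" "\<forall>a\<in>I. \<forall>b\<in>I. a - b \<in> I" "\<And>k. k \<in> K \<Longrightarrow> f k \<in> I"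
  shows "sum f K \<in> I"
  using assms(3) by (induction K rule: infinite_finite_induct)
    (auto simp: assms(1) intro: diff_closed_add[OF assms(1,2)])

section \<open>Maximal stable sets and their idealizers\<close>

locale maximal_stable =
  fixes A I :: "'a::field set"
  assumes stable: "proper_stable A I"
    and maximal: "\<And>J. proper_stable A J \<Longrightarrow> I \<subseteq> J \<Longrightarrow> J = I"
begin

lemma zero: "0 \<in> I" and one: "1 \<notin> I"
  and diff: "a \<in> I \<Longrightarrow> b \<in> I \<Longrightarrow> a - b \<in> I"
  and mult: "a \<in> I \<Longrightarrow> b \<in> I \<Longrightarrow> a * b \<in> I"
  and absorb: "r \<in> A \<Longrightarrow> a \<in> I \<Longrightarrow> r * a \<in> I"
  using stable by (auto simp: proper_stable_def)

lemma add: "a \<in> I \<Longrightarrow> b \<in> I \<Longrightarrow> a + b \<in> I"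
  using diff_closed_add[OF zero] diff by blast

lemma sum_mem: "(\<And>k. k \<in> K \<Longrightarrow> f k \<in> I) \<Longrightarrow> sum f K \<in> I"
  using diff_closed_sum[OF zero] diff by blast

text \<open>The fractions \<open>a / (1 - b)\<close> over \<open>I\<close> form a stable set
  containing \<open>I\<close>, and \<open>1 = a / (1 - b)\<close> would put \<open>1 = a + b\<close>
  into \<open>I\<close>. By maximality this localization adds nothing.\<close>

lemma divide_one_minus:
  assumes "a \<in> I" "b \<in> I"
  shows "a / (1 - b) \<in> I"
proof -
  define J where "J = {a / (1 - b) |a b. a \<in> I \<and> b \<in> I}"
  have nz: "1 - b \<noteq> 0" if "b \<in> I" for b
    using that one by auto
  have sub: "I \<subseteq> J"
    unfolding J_def using zero by force
  have "proper_stable A J"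
    unfolding proper_stable_def
  proof (intro conjI ballI)
    show "0 \<in> J"
      using sub zero by blast
    show "1 \<notin> J"
    proof
      assume "1 \<in> J"
      then obtain a b where ab: "a \<in> I" "b \<in> I" "1 = a / (1 - b)"
        by (auto simp: J_def)
      then have "a + b = 1"
        using nz[of b] by (simp add: field_simps)
      then show False
        using add[OF ab(1,2)] one by simp
    qed
    show "r * x \<in> J" if r: "r \<in> A" and x: "x \<in> J" for r x
    proof -
      obtain a b where ab: "a \<in> I" "b \<in> I" "x = a / (1 - b)"
        using x by (auto simp: J_def)
      then have "r * x = (r * a) / (1 - b)" "r * a \<in> I"
        using r absorb by auto
      then show ?thesis
        unfolding J_def using ab by blast
    qed
    fix x y
    assume "x \<in> J" "y \<in> J"
    then obtain a b c d where xy: "a \<in> I" "b \<in> I" "x = a / (1 - b)"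
      "c \<in> I" "d \<in> I" "y = c / (1 - d)"
      by (auto simp: J_def)
    \<comment> \<open>The common denominator \<open>(1 - b) * (1 - d)\<close> is again 1 minus an
      element of \<open>I\<close>.\<close>
    have den: "b + d - b * d \<in> I" "1 - (b + d - b * d) = (1 - b) * (1 - d)"
      using xy by (auto intro: add diff mult simp: algebra_simps)
    have "x - y = (a * (1 - d) - c * (1 - b)) / (1 - (b + d - b * d))"
      unfolding den(2) xy by (rule diff_frac_eq) (use xy nz in auto)
    also have "a * (1 - d) - c * (1 - b) = a - a * d - (c - c * b)"
      by (simp add: right_diff_distrib)
    finally have "x - y = (a - a * d - (c - c * b)) / (1 - (b + d - b * d))" .
    moreover have "a - a * d - (c - c * b) \<in> I"
      using xy by (intro diff mult)
    ultimately show "x - y \<in> J"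
      unfolding J_def using den(1) by blast
    have "x * y = (a * c) / (1 - (b + d - b * d))"
      unfolding den(2) using xy by simp
    then show "x * y \<in> J"
      unfolding J_def using den(1) xy mult by blast
  qed
  then have "J = I"
    using maximal sub by blast
  then show ?thesis
    using assms by (auto simp: J_def)
qed

text \<open>The largest set of multipliers that keep \<open>I\<close> stable. It contains
  \<open>I\<close>, because \<open>I\<close> is closed under products, and turns out to be the
  valuation ring.\<close>

definition idealizer :: "'a set" where
  "idealizer = {x. \<forall>a\<in>I. x * a \<in> I}"

text \<open>The values at \<open>x\<close> of polynomials over \<open>I\<close> form a set that
  contains \<open>I\<close> and \<open>x * I\<close> and has all closure properties. If it omitted
  1, maximality would make it equal to \<open>I\<close>, and then \<open>x\<close> would multiply
  \<open>I\<close> into itself.\<close>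

lemma unit_combination:
  assumes "x \<notin> idealizer"
  shows "\<exists>p. (\<forall>k. coeff p k \<in> I) \<and> poly p x = 1"
proof (rule ccontr)
  assume none: "\<not> ?thesis"
  define J where "J = {poly p x |p. \<forall>k. coeff p k \<in> I}"
  have sub: "I \<subseteq> J"
  proof
    fix a assume "a \<in> I"
    then have "a = poly [:a:] x" "\<forall>k. coeff [:a:] k \<in> I"
      by (auto simp: coeff_pCons zero split: nat.split)
    then show "a \<in> J"
      unfolding J_def by blast
  qed
  have "proper_stable A J"
    unfolding proper_stable_def
  proof (intro conjI ballI)
    show "0 \<in> J"
      using sub zero by blast
    show "1 \<notin> J"
      using none unfolding J_def by force
    show "r * y \<in> J" if r: "r \<in> A" and y: "y \<in> J" for r y
    proof -
      obtain p where "\<forall>k. coeff p k \<in> I" "y = poly p x"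
        using y by (auto simp: J_def)
      then have "r * y = poly (smult r p) x" "\<forall>k. coeff (smult r p) k \<in> I"
        using r absorb by auto
      then show ?thesis
        unfolding J_def by blast
    qed
    fix y z
    assume "y \<in> J" "z \<in> J"
    then obtain p q where pq: "\<forall>k. coeff p k \<in> I" "y = poly p x"
      "\<forall>k. coeff q k \<in> I" "z = poly q x"
      by (auto simp: J_def)
    have "y - z = poly (p - q) x" "\<forall>k. coeff (p - q) k \<in> I"
      using pq diff by auto
    then show "y - z \<in> J"
      unfolding J_def by blast
    have "y * z = poly (p * q) x" "\<forall>k. coeff (p * q) k \<in> I"
      using pq mult by (auto simp: coeff_mult intro!: sum_mem)
    then show "y * z \<in> J"
      unfolding J_def by blast
  qed
  then have "J = I"
    using maximal sub by blast
  have "x * a \<in> J" if "a \<in> I" for a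
  proof -
    have "x * a = poly [:0, a:] x" "\<forall>k. coeff [:0, a:] k \<in> I"
      using that by (auto simp: coeff_pCons zero split: nat.split)
    then show ?thesis
      unfolding J_def by blast
  qed
  then show False
    using assms \<open>J = I\<close> by (simp add: idealizer_def)
qed

text \<open>The constant term \<open>b\<close> is moved to the right-hand side and the relation is
  divided by \<open>1 - b\<close>; by \<open>divide_one_minus\<close> the coefficients stay in
  \<open>I\<close>.\<close>

lemma unit_combination_no_constant:
  assumes "\<forall>k. coeff q k \<in> I" "poly q y = 1"
  obtains q' where "\<forall>k. coeff q' k \<in> I" "poly q' y = 1" "coeff q' 0 = 0" "degree q' \<le> degree q"
proof -
  define b where "b = coeff q 0"
  have nz: "1 - b \<noteq> 0"
    using one assms(1) unfolding b_def by (metis eq_iff_diff_eq_0)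
  define q' where "q' = smult (inverse (1 - b)) (q - [:b:])"
  have "coeff q' k \<in> I" for k
    using divide_one_minus[of "coeff q k" b] assms(1) zero
    by (auto simp: q'_def b_def coeff_pCons divide_inverse mult.commute split: nat.split)
  moreover have "poly q' y = 1"
    using nz by (simp add: q'_def assms(2))
  moreover have "coeff q' 0 = 0"
    by (simp add: q'_def b_def)
  moreover have "degree q' \<le> degree q"
    unfolding q'_def
    by (rule order_trans[OF degree_smult_le]) (simp add: degree_diff_le)
  ultimately show ?thesis
    using that by blast
qed

text \<open>Multiplying the relation for \<open>inverse x\<close> by \<open>x ^ n\<close>, with
  \<open>n\<close> the degree of \<open>p\<close>, expresses \<open>x ^ n\<close> through lower
  powers of \<open>x\<close>. Substituting this for the leading power in \<open>p\<close> lowers the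
  degree.\<close>

lemma degree_descent:
  assumes x: "x \<noteq> 0"
    and p: "\<forall>k. coeff p k \<in> I" "poly p x = 1"
    and q: "\<forall>k. coeff q k \<in> I" "poly q (inverse x) = 1"
    and deg: "degree q \<le> degree p"
  shows "\<exists>p'. (\<forall>k. coeff p' k \<in> I) \<and> poly p' x = 1 \<and> degree p' < degree p"
proof -
  obtain q' where q': "\<forall>k. coeff q' k \<in> I" "poly q' (inverse x) = 1" "coeff q' 0 = 0"
    "degree q' \<le> degree q"
    using unit_combination_no_constant[OF q] by blast
  define n where "n = degree p"
  have n: "0 < n"
  proof (rule ccontr)
    assume "\<not> 0 < n"
    then obtain a where "p = [:a:]"
      unfolding n_def by (metis degree_eq_zeroE not_gr_zero)
    then show False
      using p one by (auto dest: spec[of _ 0])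
  qed
  define a where "a = coeff p n"
  \<comment> \<open>This is \<open>x ^ n\<close> times the value of \<open>q'\<close> at
    \<open>inverse x\<close>, written as a polynomial in \<open>x\<close>. The sum starts at 1
    because \<open>q'\<close> has no constant term, so every exponent is below \<open>n\<close>;
    none is truncated, as \<open>q'\<close> has degree at most \<open>n\<close>.\<close>
  define r where "r = (\<Sum>k = 1..n. monom (coeff q' k) (n - k))"
  have "poly r x = x ^ n"
  proof -
    have "poly r x = (\<Sum>k = 1..n. coeff q' k * x ^ (n - k))"
      by (simp add: r_def poly_sum poly_monom)
    also have "\<dots> = (\<Sum>k = 1..n. x ^ n * (coeff q' k * inverse x ^ k))"
      using x by (intro sum.cong) (auto simp: power_diff field_simps)
    also have "\<dots> = x ^ n * (\<Sum>k\<le>n. coeff q' k * inverse x ^ k)"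
      by (simp add: q'(3) sum_distrib_left atMost_atLeast0 sum.atLeast_Suc_atMost)
    also have "(\<Sum>k\<le>n. coeff q' k * inverse x ^ k) = poly q' (inverse x)"
      unfolding poly_altdef using q'(4) deg
      by (intro sum.mono_neutral_right) (auto simp: n_def coeff_eq_0)
    finally show ?thesis
      by (simp add: q'(2))
  qed
  moreover define p' where "p' = p - monom a n + smult a r"
  ultimately have "poly p' x = 1"
    by (simp add: p(2) poly_monom)
  moreover have "coeff r k \<in> I" for k
    using q'(1) zero by (auto simp: r_def coeff_sum intro!: sum_mem)
  then have "coeff p' k \<in> I" for k
    using p(1) zero by (auto simp: p'_def a_def intro!: add diff mult)
  moreover have "degree p' \<le> n - 1"
  proof (rule degree_le, intro allI impI)
    fix k assume k: "n - 1 < k"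
    then have "coeff r k = 0"
      by (auto simp: r_def coeff_sum intro!: sum.neutral)
    then show "coeff p' k = 0"
      using k n by (cases "k = n") (auto simp: p'_def a_def n_def coeff_eq_0)
  qed
  ultimately show ?thesis
    using n by (intro exI[of _ p']) (auto simp: n_def)
qed

text \<open>Infinite descent on the sum of the degrees. The longer relation is shortened each time;
  when it is the one for \<open>inverse x\<close>, the roles of \<open>x\<close> and
  \<open>inverse x\<close> are exchanged.\<close>

lemma no_unit_combinations:
  assumes "x \<noteq> 0" "\<forall>k. coeff p k \<in> I" "poly p x = 1"
    "\<forall>k. coeff q k \<in> I" "poly q (inverse x) = 1"
  shows False
  using assms
proof (induction "degree p + degree q" arbitrary: x p q rule: less_induct)
  case less
  show False
  proof (cases "degree q \<le> degree p")
    case True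
    then obtain p' where "\<forall>k. coeff p' k \<in> I" "poly p' x = 1" "degree p' < degree p"
      using degree_descent[OF less.prems] by blast
    then show False
      using less.hyps[of p' q x] less.prems by simp
  next
    case False
    then obtain q' where "\<forall>k. coeff q' k \<in> I" "poly q' (inverse x) = 1" "degree q' < degree q"
      using degree_descent[of "inverse x" q p] less.prems by auto
    then show False
      using less.hyps[of p q' x] less.prems by simp
  qed
qed

lemma valuation_ring_idealizer: "valuation_ring idealizer"
proof -
  have "x \<in> idealizer \<or> inverse x \<in> idealizer" for x
  proof (cases "x = 0")
    case False
    then show ?thesis
      using unit_combination no_unit_combinations by meson
  qed (simp add: idealizer_def zero)
  then show ?thesis
    by (auto simp: valuation_ring_def idealizer_def left_diff_distrib mult.assoc diff)
qed

end

text \<open>Zorn's lemma enlarges \<open>I\<close> to a maximal stable \<open>J\<close>, whose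
  idealizer is \<open>R\<close>. If \<open>x\<close> in \<open>J\<close> had its inverse in
  \<open>R\<close>, then \<open>1 = inverse x * x\<close> would lie in \<open>J\<close>.\<close>

theorem chevalley:
  assumes "proper_stable A I"
  obtains R where "valuation_ring R" "A \<subseteq> R" "I \<subseteq> R" "\<And>x. x \<in> I \<Longrightarrow> x \<noteq> 0 \<Longrightarrow> inverse x \<notin> R"
proof -
  define \<F> where "\<F> = {J. proper_stable A J \<and> I \<subseteq> J}"
  have "\<exists>J\<in>\<F>. \<forall>K\<in>\<F>. J \<subseteq> K \<longrightarrow> K = J"
  proof (rule subset_Zorn_nonempty)
    show "\<F> \<noteq> {}"
      using assms by (auto simp: \<F>_def)
    fix \<C> assume ne: "\<C> \<noteq> {}" and chain: "subset.chain \<F> \<C>"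
    have st: "proper_stable A J" "I \<subseteq> J" if "J \<in> \<C>" for J
      using chain that by (auto simp: subset_chain_def \<F>_def)
    have common: "\<exists>J\<in>\<C>. a \<in> J \<and> b \<in> J" if ab: "a \<in> \<Union>\<C>" "b \<in> \<Union>\<C>" for a b
    proof -
      obtain J K where JK: "J \<in> \<C>" "a \<in> J" "K \<in> \<C>" "b \<in> K"
        using ab by blast
      then have "J \<subseteq> K \<or> K \<subseteq> J"
        using chain unfolding subset_chain_def by blast
      then show ?thesis
        using JK by blast
    qed
    have "proper_stable A (\<Union>\<C>)"
      unfolding proper_stable_def
    proof (intro conjI ballI)
      show "0 \<in> \<Union>\<C>" "1 \<notin> \<Union>\<C>"
        using ne st by (auto simp: proper_stable_def)
      show "r * a \<in> \<Union>\<C>" if "r \<in> A" "a \<in> \<Union>\<C>" for r a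
        using that st(1) unfolding proper_stable_def by blast
      fix a b assume "a \<in> \<Union>\<C>" "b \<in> \<Union>\<C>"
      then obtain J where "J \<in> \<C>" "a \<in> J" "b \<in> J"
        using common by blast
      then show "a - b \<in> \<Union>\<C>" "a * b \<in> \<Union>\<C>"
        using st(1)[of J] by (auto simp: proper_stable_def)
    qed
    then show "\<Union>\<C> \<in> \<F>"
      using ne st by (auto simp: \<F>_def)
  qed
  then obtain J where J: "proper_stable A J" "I \<subseteq> J"
    and max: "\<And>K. proper_stable A K \<Longrightarrow> J \<subseteq> K \<Longrightarrow> K = J"
    unfolding \<F>_def by (auto intro: order_trans)
  interpret maximal_stable A J
    using J max by unfold_locales
  show ?thesis
  proof
    show "valuation_ring idealizer"
      by (rule valuation_ring_idealizer)
    show "A \<subseteq> idealizer" "I \<subseteq> idealizer"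
      using absorb mult J(2) by (auto simp: idealizer_def)
    show "inverse x \<notin> idealizer" if "x \<in> I" "x \<noteq> 0" for x
      using that one J(2) by (auto simp: idealizer_def intro!: bexI[of _ x])
  qed
qed


section \<open>The valuation of a valuation ring over the base field\<close>

definition ring_unit :: "'a::field set \<Rightarrow> 'a \<Rightarrow> bool" where
  "ring_unit R x \<longleftrightarrow> x \<noteq> 0 \<and> x \<in> R \<and> inverse x \<in> R"

lemma ring_unit_inverse: "ring_unit R x \<Longrightarrow> ring_unit R (inverse x)"
  by (simp add: ring_unit_def)

section \<open>Arithmetic of units in a valuation ring\<close>

context
  fixes R :: "'a::field set"
  assumes R: "valuation_ring R"
begin

lemma vr_diff: "x \<in> R \<Longrightarrow> y \<in> R \<Longrightarrow> x - y \<in> R"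
  and vr_mult: "x \<in> R \<Longrightarrow> y \<in> R \<Longrightarrow> x * y \<in> R"
  and vr_total: "x \<in> R \<or> inverse x \<in> R"
  using R by (auto simp: valuation_ring_def)

lemma vr_zero: "0 \<in> R" and vr_one: "1 \<in> R"
  using vr_total[of 0] vr_total[of 1] by simp_all

lemma vr_add: "x \<in> R \<Longrightarrow> y \<in> R \<Longrightarrow> x + y \<in> R"
  using diff_closed_add[OF vr_zero] vr_diff by blast

lemma vr_power: "x \<in> R \<Longrightarrow> x ^ n \<in> R"
  by (induction n) (simp_all add: vr_one vr_mult)

text \<open>A simple case of integral closedness: if \<open>x\<close> were outside \<open>R\<close>,
  its inverse would be in \<open>R\<close>, and so would
  \<open>x = x ^ n * inverse x ^ (n - 1)\<close>.\<close>

lemma vr_power_iff: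
  assumes "0 < n"
  shows "x ^ n \<in> R \<longleftrightarrow> x \<in> R"
proof
  assume xn: "x ^ n \<in> R"
  show "x \<in> R"
  proof (rule ccontr)
    assume x: "x \<notin> R"
    then have "x \<noteq> 0" "inverse x \<in> R"
      using vr_zero vr_total[of x] by auto
    moreover obtain k where "n = Suc k"
      using assms gr0_conv_Suc by blast
    moreover have "x ^ n * inverse x ^ k \<in> R"
      using xn \<open>inverse x \<in> R\<close> by (simp add: vr_mult vr_power del: power_inverse)
    ultimately have "x \<in> R"
      by (simp add: power_inverse mult.assoc)
    with x show False
      by simp
  qed
qed (rule vr_power)

lemma ring_unit_mult: "ring_unit R x \<Longrightarrow> ring_unit R y \<Longrightarrow> ring_unit R (x * y)"
  by (simp add: ring_unit_def vr_mult)

lemma ring_unit_power: "ring_unit R x \<Longrightarrow> ring_unit R (x ^ n)"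
  by (simp add: ring_unit_def vr_power flip: power_inverse)

lemma ring_unit_one: "ring_unit R 1"
  by (simp add: ring_unit_def vr_one)

lemma ring_unit_mult_mem_iff:
  assumes "ring_unit R x"
  shows "x * y \<in> R \<longleftrightarrow> y \<in> R"
proof
  assume "x * y \<in> R"
  then have "inverse x * (x * y) \<in> R"
    using assms by (simp add: ring_unit_def vr_mult)
  then show "y \<in> R"
    using assms by (simp add: ring_unit_def flip: mult.assoc)
qed (use assms in \<open>simp add: ring_unit_def vr_mult\<close>)

text \<open>This is the locality of \<open>R\<close>. For a nonzero nonunit \<open>z\<close>,
  \<open>inverse z\<close> and hence \<open>(1 + z) / z\<close> lie outside \<open>R\<close>, so
  \<open>z / (1 + z)\<close> lies in \<open>R\<close>, and \<open>inverse (1 + z)\<close> is 1 minus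
  it.\<close>

lemma ring_unit_one_plus:
  assumes "z \<in> R" "\<not> ring_unit R z"
  shows "ring_unit R (1 + z)"
proof (cases "z = 0")
  case False
  have nz: "1 + z \<noteq> 0"
  proof
    assume "1 + z = 0"
    then have "z = 0 - 1"
      by (simp add: eq_neg_iff_add_eq_0 add.commute)
    then show False
      using assms vr_diff[OF vr_zero vr_one] by (auto simp: ring_unit_def)
  qed
  have "inverse z \<notin> R"
    using assms False by (simp add: ring_unit_def)
  moreover have "inverse z = (1 + z) / z - 1"
    using False by (simp add: field_simps)
  ultimately have "(1 + z) / z \<notin> R"
    using vr_diff[OF _ vr_one] by metis
  then have "z / (1 + z) \<in> R"
    using vr_total[of "(1 + z) / z"] by simp
  moreover have "inverse (1 + z) = 1 - z / (1 + z)"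
    using nz by (simp add: field_simps)
  ultimately show ?thesis
    using nz assms(1) vr_add vr_diff vr_one by (simp add: ring_unit_def)
qed (simp add: ring_unit_one)

text \<open>The ultrametric principle that a sum of terms with pairwise distinct values has the
  value of one of its terms, expressed through units because no value function exists yet.\<close>

lemma sum_associated_to_term:
  assumes "finite K" "K \<noteq> {}"
    and "\<And>k. k \<in> K \<Longrightarrow> t k \<noteq> 0"
    and "\<And>k l. k \<in> K \<Longrightarrow> l \<in> K \<Longrightarrow> k \<noteq> l \<Longrightarrow> \<not> ring_unit R (t k / t l)"
  shows "\<exists>k\<in>K. ring_unit R (sum t K / t k)"
  using assms
proof (induction rule: finite_ne_induct)
  case (singleton k)
  then show ?case
    by (simp add: ring_unit_one)
next
  case (insert l K)
  then have "\<exists>k\<in>K. ring_unit R (sum t K / t k)"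
    by blast
  then obtain k where k: "k \<in> K" "ring_unit R (sum t K / t k)"
    by blast
  define s where "s = sum t K"
  have s: "ring_unit R (s / t k)"
    using k by (simp add: s_def)
  then have nz: "s \<noteq> 0" "t l \<noteq> 0"
    using insert.prems by (auto simp: ring_unit_def)
  have nu: "\<not> ring_unit R (t l / s)"
  proof
    assume "ring_unit R (t l / s)"
    then have "ring_unit R (t l / s * (s / t k))"
      using s by (rule ring_unit_mult)
    then show False
      using insert k(1) nz by auto
  qed
  show ?case
  \<comment> \<open>Whichever of \<open>s\<close> and \<open>t l\<close> divides the other is
    factored out of \<open>t l + s\<close>; the cofactor is 1 plus a nonunit, hence a unit.\<close>
  proof (cases "t l / s \<in> R")
    case True
    then have "ring_unit R ((1 + t l / s) * (s / t k))"
      using nu s by (intro ring_unit_mult ring_unit_one_plus)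
    moreover have "(1 + t l / s) * s = t l + s"
      using nz by (simp add: distrib_right)
    ultimately have "ring_unit R ((t l + s) / t k)"
      by (metis times_divide_eq_right)
    then show ?thesis
      using k(1) insert.hyps by (auto simp: s_def)
  next
    case False
    then have "s / t l \<in> R"
      using vr_total[of "t l / s"] by simp
    moreover have "\<not> ring_unit R (s / t l)"
      using nu ring_unit_inverse[of R "s / t l"] by auto
    ultimately have "ring_unit R (1 + s / t l)"
      by (rule ring_unit_one_plus)
    then have "ring_unit R ((t l + s) / t l)"
      using nz by (simp add: add_divide_distrib)
    then show ?thesis
      using insert.hyps by (auto simp: s_def)
  qed
qed

end

section \<open>Elementary facts on valuations and field embeddings\<close>

lemma valuation_one: "valuation v \<Longrightarrow> v 1 = Fin 0"
proof -
  assume v: "valuation v"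
  then have "v (1 * 1) = v 1 + v 1" "v 1 \<noteq> Infty"
    unfolding valuation_def by (blast, simp)
  then show ?thesis
    by (cases "v 1") simp_all
qed

lemma valuation_Fin:
  assumes "valuation v" "c \<noteq> 0"
  obtains \<gamma> where "v c = Fin \<gamma>"
  using assms by (cases "v c") (auto simp: valuation_def)

lemma valuation_Fin_nonzero: "valuation v \<Longrightarrow> v c = Fin \<gamma> \<Longrightarrow> c \<noteq> 0"
  by (metis valuation_def with_inf.distinct(1))

lemma valuation_mult: "valuation v \<Longrightarrow> v (x * y) = v x + v y"
  by (simp add: valuation_def)

lemma valuation_power: "valuation v \<Longrightarrow> v c = Fin \<gamma> \<Longrightarrow> v (c ^ n) = Fin (nmult n \<gamma>)"
  by (induction n) (simp_all add: valuation_one valuation_mult)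

lemma valuation_inverse:
  assumes "valuation v" "v c = Fin \<gamma>"
  shows "v (inverse c) = Fin (- \<gamma>)"
proof -
  have c: "c \<noteq> 0"
    using assms by (rule valuation_Fin_nonzero)
  then obtain \<delta> where \<delta>: "v (inverse c) = Fin \<delta>"
    using valuation_Fin[OF assms(1)] by (metis inverse_nonzero_iff_nonzero)
  have "v (c * inverse c) = Fin (\<gamma> + \<delta>)"
    by (simp only: valuation_mult[OF assms(1)] assms(2) \<delta> plus_with_inf.simps)
  then have "\<gamma> + \<delta> = 0"
    using c valuation_one[OF assms(1)] by simp
  then show ?thesis
    using \<delta> by (simp add: eq_neg_iff_add_eq_0 add.commute)
qed

lemma field_embedding_hom:
  assumes "field_embedding i"
  shows "i 1 = 1" "i (a * b) = i a * i b" "i (a + b) = i a + i b" "i 0 = 0" "i (- a) = - i a"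
    "i (a ^ n) = i a ^ n" "i a = 0 \<longleftrightarrow> a = 0" "i (inverse a) = inverse (i a)"
    "i (a / b) = i a / i b"
proof -
  show one: "i 1 = 1" and mult: "i (a * b) = i a * i b" and add: "i (a + b) = i a + i b" for a b
    using assms by (simp_all add: field_embedding_def)
  show zero: "i 0 = 0"
    using add[of 0 0] by (metis add_0 add_cancel_right_left)
  have neg: "i (- a) = - i a" for a
    using add[of "- a" a] zero by (simp add: eq_neg_iff_add_eq_0)
  then show "i (- a) = - i a" .
  show "i (a ^ n) = i a ^ n"
    by (induction n) (simp_all add: one mult)
  have inv: "i a * i (inverse a) = 1" if "a \<noteq> 0" for a
    using that mult[of a "inverse a"] one by simp
  show nz: "i a = 0 \<longleftrightarrow> a = 0"
    using inv[of a] zero by (cases "a = 0") auto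
  have inverse: "i (inverse a) = inverse (i a)" for a
    using inv[of a] zero by (cases "a = 0") (auto intro: inverse_unique[symmetric])
  then show "i (inverse a) = inverse (i a)" .
  show "i (a / b) = i a / i b"
    by (simp add: divide_inverse mult inverse)
qed

text \<open>Powers of \<open>x\<close> satisfy a linear relation over the base field; two of its terms are associated,
  since otherwise the sum would be associated to one of the terms and hence nonzero.\<close>

lemma power_associated_to_base:
  assumes fin: "finite_extension i" and R: "valuation_ring R" and x: "x \<noteq> 0"
  shows "\<exists>n c. 0 < n \<and> c \<noteq> 0 \<and> ring_unit R (x ^ n / i c)"
proof -
  have emb: "field_embedding i"
    using fin by (simp add: finite_extension_def)
  note hom = field_embedding_hom[OF emb]
  obtain B where B: "finite_dimensional_vector_space (\<lambda>a y. i a * y) B"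
    using fin by (auto simp: finite_extension_def)
  interpret E: finite_dimensional_vector_space "\<lambda>a y. i a * y" B
    by (rule B)
  \<comment> \<open>Cancelling the smaller power in the quotient of two associated terms leaves a
    power of \<open>x\<close> with positive exponent over an element of the base field, after
    inversion if \<open>k < l\<close>.\<close>
  have quot: ?thesis if kl: "k \<noteq> l" and ab: "a \<noteq> 0" "b \<noteq> 0"
    and un: "ring_unit R (i a * x ^ k / (i b * x ^ l))" for k l a b
  proof (cases "l < k")
    case True
    have "i a * x ^ k / (i b * x ^ l) = x ^ (k - l) / i (b * inverse a)"
      using True x ab by (simp add: hom power_diff field_simps)
    then show ?thesis
      using True ab un
      by (intro exI[of _ "k - l"] exI[of _ "b * inverse a"]) simp
  next
    case False
    then have less: "k < l"
      using kl by simp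
    have "inverse (i a * x ^ k / (i b * x ^ l)) = x ^ (l - k) / i (a * inverse b)"
      using less x ab by (simp add: hom power_diff field_simps)
    then show ?thesis
      using less ab ring_unit_inverse[OF un]
      by (intro exI[of _ "l - k"] exI[of _ "a * inverse b"]) simp
  qed
  define N where "N = E.dimension"
  let ?S = "(\<lambda>k. x ^ k) ` {..N}"
  show ?thesis
  \<comment> \<open>Linear dependence concerns the set of powers, so a repeated power is treated
    first; it is itself a relation with coefficients 1. Otherwise there are \<open>N + 1\<close>
    distinct powers in dimension \<open>N\<close>.\<close>
  proof (cases "inj_on (\<lambda>k. x ^ k) {..N}")
    case False
    then obtain k l where "k \<noteq> l" "x ^ k = x ^ l"
      by (auto simp: inj_on_def)
    then show ?thesis
      using quot[of k l 1 1] x by (simp add: hom ring_unit_one[OF R])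
  next
    case True
    then have "E.dim ?S < card ?S"
      using E.dim_subset_UNIV[of ?S] by (simp add: card_image N_def)
    then have "E.dependent ?S"
      by (rule E.dependent_biggerset_general)
    then obtain f where f: "\<exists>y\<in>?S. f y \<noteq> 0" "(\<Sum>y\<in>?S. i (f y) * y) = 0"
      by (subst (asm) E.dependent_finite) auto
    define K where "K = {k. k \<le> N \<and> f (x ^ k) \<noteq> 0}"
    define t where "t k = i (f (x ^ k)) * x ^ k" for k
    have K: "finite K" "K \<noteq> {}"
      using f(1) by (auto simp: K_def)
    have "sum t K = sum t {..N}"
      by (intro sum.mono_neutral_left) (auto simp: K_def t_def hom)
    also have "\<dots> = 0"
      using f(2) by (simp add: sum.reindex[OF True] t_def)
    finally have "\<not> (\<exists>k\<in>K. ring_unit R (sum t K / t k))"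
      by (simp add: ring_unit_def)
    moreover have "t k \<noteq> 0" if "k \<in> K" for k
      using that x by (simp add: t_def K_def hom)
    ultimately obtain k l where "k \<in> K" "l \<in> K" "k \<noteq> l" "ring_unit R (t k / t l)"
      using sum_associated_to_term[OF R K] by blast
    then show ?thesis
      using quot[of k l] by (auto simp: t_def K_def)
  qed
qed

section \<open>The valuation with values in the divisible hull\<close>

locale valuation_ring_over =
  fixes i :: "'f::field \<Rightarrow> 'e::field"
    and v :: "'f \<Rightarrow> 'g::linordered_ab_group_add with_inf"
    and R :: "'e set"
  assumes ext: "finite_extension i"
    and v: "valuation v"
    and R: "valuation_ring R"
    and base: "i a \<in> R \<longleftrightarrow> 0 \<le> v a"
begin

lemmas hom = field_embedding_hom[OF ext[unfolded finite_extension_def, THEN conjunct1]]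

text \<open>A relation, since \<open>n\<close> and \<open>c\<close> are chosen and not determined by
  \<open>x\<close>; that the quotient of \<open>v c\<close> by \<open>n\<close> is determined is
  shown in \<open>has_value_unique\<close>.\<close>

definition has_value :: "'e \<Rightarrow> 'g div_hull \<Rightarrow> bool" where
  "has_value x q \<longleftrightarrow>
     (\<exists>n \<gamma> c. 0 < n \<and> v c = Fin \<gamma> \<and> q = hfrac \<gamma> n \<and> ring_unit R (x ^ n / i c))"

lemma has_value_exists:
  assumes "x \<noteq> 0"
  shows "\<exists>q. has_value x q"
proof -
  obtain n c where "0 < n" "c \<noteq> 0" "ring_unit R (x ^ n / i c)"
    using power_associated_to_base[OF ext R assms] by blast
  moreover from this obtain \<gamma> where "v c = Fin \<gamma>"
    using valuation_Fin[OF v] by blast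
  ultimately show ?thesis
    unfolding has_value_def by blast
qed

lemma has_value_mult:
  assumes "has_value x q" "has_value y r"
  shows "has_value (x * y) (q + r)"
proof -
  obtain n \<gamma> c where x: "0 < n" "v c = Fin \<gamma>" "q = hfrac \<gamma> n" "ring_unit R (x ^ n / i c)"
    using assms(1) by (auto simp: has_value_def)
  obtain m \<delta> d where y: "0 < m" "v d = Fin \<delta>" "r = hfrac \<delta> m" "ring_unit R (y ^ m / i d)"
    using assms(2) by (auto simp: has_value_def)
  have "ring_unit R ((x ^ n / i c) ^ m * (y ^ m / i d) ^ n)"
    using x(4) y(4) by (intro ring_unit_mult ring_unit_power R)
  also have "(x ^ n / i c) ^ m * (y ^ m / i d) ^ n = (x * y) ^ (n * m) / i (c ^ m * d ^ n)"
    by (simp add: hom power_divide power_mult_distrib mult.commute flip: power_mult)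
  finally show ?thesis
    unfolding has_value_def using x y
    by (intro exI[of _ "n * m"] exI[of _ "nmult m \<gamma> + nmult n \<delta>"] exI[of _ "c ^ m * d ^ n"])
      (simp add: hfrac_add valuation_mult[OF v] valuation_power[OF v])
qed

lemma has_value_inverse:
  assumes "has_value x q"
  shows "has_value (inverse x) (- q)"
proof -
  obtain n \<gamma> c where x: "0 < n" "v c = Fin \<gamma>" "q = hfrac \<gamma> n" "ring_unit R (x ^ n / i c)"
    using assms by (auto simp: has_value_def)
  have "inverse (x ^ n / i c) = inverse x ^ n / i (inverse c)"
    by (simp add: hom power_inverse divide_inverse mult.commute)
  then show ?thesis
    unfolding has_value_def using x ring_unit_inverse[OF x(4)]
    by (intro exI[of _ n] exI[of _ "- \<gamma>"] exI[of _ "inverse c"])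
      (simp add: hfrac_uminus valuation_inverse[OF v])
qed

text \<open>Membership of \<open>x\<close> in \<open>R\<close> passes to \<open>x ^ n\<close>, then
  to the associated element \<open>i c\<close>, and there \<open>base\<close> reads it off from the
  sign of \<open>v c\<close>.\<close>

lemma has_value_nonneg_iff:
  assumes "has_value x q"
  shows "0 \<le> q \<longleftrightarrow> x \<in> R"
proof -
  obtain n \<gamma> c where x: "0 < n" "v c = Fin \<gamma>" "q = hfrac \<gamma> n" "ring_unit R (x ^ n / i c)"
    using assms by (auto simp: has_value_def)
  have "x ^ n = (x ^ n / i c) * i c"
    using x(4) by (simp add: ring_unit_def)
  then have "x ^ n \<in> R \<longleftrightarrow> i c \<in> R"
    using ring_unit_mult_mem_iff[OF R x(4), of "i c"] by simp
  then show ?thesis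
    using x by (simp add: vr_power_iff[OF R] base hull_zero hfrac_le_iff zero_with_inf_def)
qed

lemma has_value_nonzero: "has_value x q \<Longrightarrow> x \<noteq> 0"
  by (auto simp: has_value_def ring_unit_def)

text \<open>If \<open>q\<close> and \<open>r\<close> are both values of \<open>x\<close>, then
  \<open>r - q\<close> is a value of \<open>x * inverse x = 1\<close>. As 1 lies in
  \<open>R\<close>, the difference is nonnegative, and by symmetry so is its negative.\<close>

lemma has_value_unique:
  assumes "has_value x q" "has_value x r"
  shows "q = r"
proof -
  have le: "q \<le> r" if "has_value x q" "has_value x r" for q r
  proof -
    have "has_value (x * inverse x) (r + - q)"
      using that by (intro has_value_mult has_value_inverse)
    then have "0 \<le> r + - q"
      unfolding has_value_nonneg_iff[OF \<open>has_value (x * inverse x) (r + - q)\<close>]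
      using has_value_nonzero[OF that(1)] vr_one[OF R] by simp
    then show ?thesis
      by simp
  qed
  show ?thesis
    using assms by (intro order_antisym le)
qed

definition val :: "'e \<Rightarrow> 'g div_hull with_inf" where
  "val x = (if x = 0 then Infty else Fin (THE q. has_value x q))"

lemma val_eq: "has_value x q \<Longrightarrow> val x = Fin q"
  using has_value_unique has_value_nonzero by (auto simp: val_def intro!: the_equality)

lemma val_Fin:
  assumes "x \<noteq> 0"
  obtains q where "has_value x q" "val x = Fin q"
  using has_value_exists[OF assms] val_eq by blast

lemma val_nonneg_iff: "0 \<le> val x \<longleftrightarrow> x \<in> R"
proof (cases "x = 0")
  case False
  then show ?thesis
    using val_Fin[OF False] has_value_nonneg_iff by (metis less_eq_with_inf.simps(1) zero_with_inf_def)
qed (simp add: val_def zero_with_inf_def vr_zero[OF R])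

lemma val_mult: "val (x * y) = val x + val y"
proof (cases "x = 0 \<or> y = 0")
  case True
  then show ?thesis
    by (auto simp: val_def)
next
  case False
  then obtain q r where "has_value x q" "val x = Fin q" "has_value y r" "val y = Fin r"
    using val_Fin by metis
  then show ?thesis
    using val_eq[OF has_value_mult] by simp
qed

lemma valuation_val: "valuation val"
proof -
  have le: "val x \<le> val (x + y)" if "val x \<le> val y" for x y
  proof (cases "x = 0")
    case True
    then show ?thesis
      using that by (simp add: val_def)
  next
    case False
    \<comment> \<open>The element of smaller value is factored out: \<open>y / x\<close> lies in
      \<open>R\<close>, hence so does \<open>1 + y / x\<close>.\<close>
    have y: "y = x * (y / x)" and xy: "x + y = x * (1 + y / x)"
      using False by (simp_all add: field_simps)
    have "y / x \<in> R"
    proof (cases "y = 0")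
      case False
      then show ?thesis
        using \<open>x \<noteq> 0\<close> that val_Fin[of x] val_Fin[of "y / x"] val_mult[of x "y / x"] y
          val_nonneg_iff[of "y / x"]
        by (metis divide_eq_0_iff le_add_same_cancel1 less_eq_with_inf.simps(1)
            plus_with_inf.simps(1) zero_with_inf_def)
    qed (simp add: vr_zero[OF R])
    then have "0 \<le> val (1 + y / x)"
      by (simp add: val_nonneg_iff vr_add[OF R] vr_one[OF R])
    then have "val x + 0 \<le> val x + val (1 + y / x)"
      by (rule add_left_mono)
    then show ?thesis
      unfolding xy val_mult by simp
  qed
  have "min (val x) (val y) \<le> val (x + y)" for x y
    using le[of x y] le[of y x] by (cases "val x \<le> val y") (simp_all add: min_def add.commute)
  moreover have "val x = Infty \<longleftrightarrow> x = 0" for x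
    by (simp add: val_def)
  ultimately show ?thesis
    by (simp add: valuation_def val_mult)
qed

lemma valuation_extends_val: "valuation_extends i val v"
  unfolding valuation_extends_def
proof (intro conjI allI)
  show "value_group val \<subseteq> hull_of (value_group v)"
  proof
    fix q assume "q \<in> value_group val"
    then obtain x where "x \<noteq> 0" "val x = Fin q"
      by (auto simp: value_group_def)
    then have "has_value x q"
      using val_Fin by (metis with_inf.inject)
    then obtain n \<gamma> c where c: "0 < n" "v c = Fin \<gamma>" "q = hfrac \<gamma> n"
      by (auto simp: has_value_def)
    moreover have "c \<noteq> 0"
      using valuation_Fin_nonzero[OF v] c by blast
    ultimately show "q \<in> hull_of (value_group v)"
      by (auto simp: hull_of_def value_group_def)
  qed
  show "val (i a) = map_with_inf (\<lambda>\<gamma>. hfrac \<gamma> 1) (v a)" for a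
  proof (cases "a = 0")
    case True
    moreover have "v 0 = Infty"
      using v by (simp add: valuation_def)
    ultimately show ?thesis
      by (simp add: hom val_def)
  next
    case False
    then obtain \<gamma> where "v a = Fin \<gamma>"
      using valuation_Fin[OF v] by blast
    moreover from this have "has_value (i a) (hfrac \<gamma> 1)"
      unfolding has_value_def using False
      by (intro exI[of _ 1] exI[of _ \<gamma>] exI[of _ a]) (simp add: hom ring_unit_one[OF R])
    ultimately show ?thesis
      by (simp add: val_eq)
  qed
qed

end


section \<open>Quasi-valuations\<close>

text \<open>Iterated superadditivity; \<open>w 1 = 0\<close> settles the exponent 0.\<close>

lemma quasi_valuation_power:
  assumes "quasi_valuation w" "w 1 = 0"
    and "w x = Fin m"
  shows "Fin (nmult n m) \<le> w (x ^ n)"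
proof (induction n)
  case (Suc n)
  have "Fin (nmult (Suc n) m) \<le> w x + w (x ^ n)"
    using add_left_mono[OF Suc, of "Fin m"] assms(3) by simp
  also have "\<dots> \<le> w (x * x ^ n)"
    using assms(1) by (simp add: quasi_valuation_def)
  finally show ?case
    by simp
qed (simp add: assms(2) zero_with_inf_def)

theorem theorem8p15:
  fixes i :: "'f::field \<Rightarrow> 'e::field"
    and v :: "'f \<Rightarrow> 'g::linordered_ab_group_add with_inf"
    and j :: "'g \<Rightarrow> 'm::{ordered_comm_monoid_add, linorder}"
    and w :: "'e \<Rightarrow> 'm with_inf"
  assumes "finite_extension i"
    and "valuation v"
    and "quasi_valuation w"
    and "quasi_valuation_extends i j w v"
  shows "\<exists>u :: 'e \<Rightarrow> 'g div_hull with_inf.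
           valuation u \<and> valuation_extends i u v \<and>
           nonneg_set w \<subseteq> nonneg_set u \<and> pos_set w \<subseteq> pos_set u \<and>
           dominates v j w u"
proof -
  let ?\<Gamma> = "value_group v" and ?M = "value_monoid w"
  note hom = field_embedding_hom[OF assms(1)[unfolded finite_extension_def, THEN conjunct1]]
  interpret value_setting ?\<Gamma> j ?M
    by (rule value_setting_value_group[OF assms(2,4)])
  have w0: "w 0 = Infty" and w_mult: "w x + w y \<le> w (x * y)"
    and w_add: "min (w x) (w y) \<le> w (x + y)" for x y
    using assms(3) by (simp_all add: quasi_valuation_def)
  have w_i: "w (i a) = map_with_inf j (v a)" for a
    using assms(4) by (simp add: quasi_valuation_extends_def)
  have mem: "\<gamma> \<in> ?\<Gamma>" if "v a = Fin \<gamma>" for a \<gamma>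
  proof -
    have "a \<noteq> 0"
      using that by (rule valuation_Fin_nonzero[OF assms(2)])
    then show ?thesis
      using that by (auto simp: value_group_def)
  qed
  \<comment> \<open>On the base field \<open>w\<close> and \<open>v\<close> have the same signs,
    because \<open>j\<close> preserves and reflects the order on the value group.\<close>
  have w_i_nonneg: "0 \<le> w (i a) \<longleftrightarrow> 0 \<le> v a" for a
    using j_le_iff[OF zero_mem mem] j_zero
    by (cases "v a") (auto simp: w_i zero_with_inf_def)
  have w_i_pos: "0 < w (i a) \<longleftrightarrow> 0 < v a" for a
    using j_le_iff[OF mem zero_mem] j_zero
    by (cases "v a") (auto simp: w_i zero_with_inf_def not_le[symmetric])
  have w1: "w 1 = 0"
    using w_i[of 1] valuation_one[OF assms(2)] by (simp add: hom j_zero zero_with_inf_def)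
  \<comment> \<open>The value of \<open>- 1\<close> is 2-torsion in an ordered group, hence zero. It
    is computed in the base field and carried over to \<open>w\<close>, so that \<open>w\<close>
    becomes compatible with differences.\<close>
  have "v (- 1) = Fin 0"
  proof -
    obtain \<gamma> where \<gamma>: "v (- 1) = Fin \<gamma>"
      using valuation_Fin[OF assms(2), of "- 1"] by auto
    then have "\<gamma> + \<gamma> = 0"
      using valuation_mult[OF assms(2), of "- 1" "- 1"] valuation_one[OF assms(2)] by simp
    then show ?thesis
      using \<gamma> by simp
  qed
  then have "w (- 1) = 0"
    using w_i[of "- 1"] by (simp add: hom j_zero zero_with_inf_def)
  then have w_uminus: "w x \<le> w (- x)" for x
    using w_mult[of "- 1" x] by simp
  have w_diff: "min (w x) (w y) \<le> w (x - y)" for x y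
    using w_add[of x "- y"] w_uminus[of y] by (auto simp: min_def split: if_splits)
  \<comment> \<open>Addition is only weakly monotone, so strictness comes from the chain
    \<open>0 < w y \<le> w x + w y \<le> w (x * y)\<close>.\<close>
  have w_mult_pos: "0 < w (x * y)" if "0 \<le> w x" "0 < w y" for x y
    using that w_mult[of x y] add_right_mono[of 0 "w x" "w y"] by simp
  have "proper_stable (nonneg_set w) (pos_set w)"
    unfolding proper_stable_def nonneg_set_def pos_set_def
  proof (intro conjI ballI CollectI; (elim CollectE)?)
    show "0 < w 0" "1 \<notin> {x. 0 < w x}"
      by (simp_all add: w0 w1 less_with_inf_def zero_with_inf_def)
    show "0 < w (a - b)" if "0 < w a" "0 < w b" for a b
      using that w_diff[of a b] by (auto simp: min_def split: if_splits)
  qed (auto intro: w_mult_pos less_imp_le)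
  then obtain R where vr: "valuation_ring R" "nonneg_set w \<subseteq> R" "pos_set w \<subseteq> R"
    and inv: "\<And>x. x \<in> pos_set w \<Longrightarrow> x \<noteq> 0 \<Longrightarrow> inverse x \<notin> R"
    by (rule chevalley) blast
  have base: "i a \<in> R \<longleftrightarrow> 0 \<le> v a" for a
  proof
    assume ia: "i a \<in> R"
    show "0 \<le> v a"
    proof (rule ccontr)
      \<comment> \<open>Then \<open>i (inverse a)\<close> has positive \<open>w\<close>-value, so
        its inverse \<open>i a\<close> is excluded from \<open>R\<close>.\<close>
      assume neg: "\<not> 0 \<le> v a"
      then obtain \<gamma> where \<gamma>: "v a = Fin \<gamma>" "\<gamma> < 0"
        by (cases "v a") (auto simp: zero_with_inf_def)
      then have "0 < v (inverse a)"
        using valuation_inverse[OF assms(2)] by (auto simp: less_with_inf_def zero_with_inf_def)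
      moreover have "a \<noteq> 0"
        using valuation_Fin_nonzero[OF assms(2) \<gamma>(1)] .
      ultimately show False
        using inv[of "i (inverse a)"] ia w_i_pos[of "inverse a"] by (simp add: pos_set_def hom)
    qed
  next
    assume "0 \<le> v a"
    then show "i a \<in> R"
      using vr(2) w_i_nonneg by (auto simp: nonneg_set_def)
  qed
  interpret valuation_ring_over i v R
    using assms vr base by unfold_locales
  have pos: "0 < val x" if "x \<in> pos_set w" for x
  proof (cases "x = 0")
    case False
    then obtain q where q: "has_value x q" "val x = Fin q"
      using val_Fin by blast
    have "x \<in> R" "inverse x \<notin> R"
      using that False vr(3) inv by blast+
    then have "0 \<le> q" "\<not> 0 \<le> - q"
      using has_value_nonneg_iff[OF q(1)] has_value_nonneg_iff[OF has_value_inverse[OF q(1)]]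
      by auto
    then show ?thesis
      using q(2) by (simp add: less_with_inf_def zero_with_inf_def)
  qed (simp add: val_def less_with_inf_def zero_with_inf_def)
  \<comment> \<open>An infinite value at a nonzero \<open>x\<close> would force
    \<open>w (x * inverse x) = w 1\<close> to be infinite.\<close>
  have w_fin: "w x \<noteq> Infty" if "x \<noteq> 0" for x
  proof
    assume "w x = Infty"
    then show False
      using that w_mult[of x "inverse x"] w1 by (simp add: zero_with_inf_def)
  qed
  have "dominates v j w val"
    unfolding dominates_def Let_def
  proof
    fix x
    show "le_with_inf (T_le ?\<Gamma> j ?M)
            (map_with_inf (\<lambda>m. T_class ?\<Gamma> j ?M (Inl m)) (w x))
            (map_with_inf (\<lambda>q. T_class ?\<Gamma> j ?M (Inr q)) (val x))"
    proof (cases "x = 0")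
      case True
      then show ?thesis
        by (simp add: w0 val_def)
    next
      case False
      then obtain q where q: "has_value x q" "val x = Fin q"
        using val_Fin by blast
      obtain n \<gamma> c where c: "0 < n" "v c = Fin \<gamma>" "q = hfrac \<gamma> n" "ring_unit R (x ^ n / i c)"
        using q(1) by (auto simp: has_value_def)
      obtain m where m: "w x = Fin m"
        using w_fin[OF False] by (cases "w x") auto
      have \<gamma>: "\<gamma> \<in> ?\<Gamma>"
        using mem c by blast
      have "nmult n m \<le> j \<gamma>"
      proof (rule ccontr)
        assume "\<not> nmult n m \<le> j \<gamma>"
        then have less: "j \<gamma> < nmult n m"
          by simp
        have j0: "j \<gamma> + j (- \<gamma>) = 0"
          using j_add[OF \<gamma> uminus_mem[OF \<gamma>]] j_zero by simp
        \<comment> \<open>A strict inequality may become an equality under addition in the monoid;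
          here it survives because \<open>j (- \<gamma>)\<close> is invertible and adding
          \<open>j \<gamma>\<close> undoes the shift.\<close>
        have "\<not> nmult n m + j (- \<gamma>) \<le> 0"
        proof
          assume "nmult n m + j (- \<gamma>) \<le> 0"
          then have "nmult n m + j (- \<gamma>) + j \<gamma> \<le> 0 + j \<gamma>"
            by (rule add_right_mono)
          then show False
            using less j0 by (simp add: add.assoc add.commute[of "j (- \<gamma>)"])
        qed
        then have "0 < Fin (nmult n m + j (- \<gamma>))"
          by (simp add: less_with_inf_def zero_with_inf_def)
        also have "\<dots> \<le> w (x ^ n) + w (i (inverse c))"
          using add_right_mono[OF quasi_valuation_power[OF assms(3) w1 m, of n], of "Fin (j (- \<gamma>))"]
          by (simp add: w_i valuation_inverse[OF assms(2) c(2)])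
        also have "\<dots> \<le> w (x ^ n / i c)"
          using w_mult[of "x ^ n" "i (inverse c)"] by (simp add: hom divide_inverse)
        finally have "x ^ n / i c \<in> pos_set w"
          by (simp add: pos_set_def)
        then show False
          using inv c(4) unfolding ring_unit_def by blast
      qed
      \<comment> \<open>The inequality just proved is the comparison of the fractions
        \<open>(m, 1)\<close> and \<open>(j \<gamma>, n)\<close> with multiplier
        \<open>t = 1\<close>.\<close>
      then have "phi ?\<Gamma> j (Inl m) \<le> phi ?\<Gamma> j (Inr q)"
        using c(1) \<gamma> by (auto simp: c(3) phi_hfrac phi_Inl mfrac_le_iff intro!: exI[of _ 1])
      moreover have "Inl m \<in> T_set ?\<Gamma> ?M" "Inr q \<in> T_set ?\<Gamma> ?M"
        using False m c \<gamma> unfolding T_set_def value_monoid_def hull_of_def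
        by (auto intro: submonoid_generated.incl)
      \<comment> \<open>\<open>Inr q\<close> is never singular, so the order on classes is decided
        by \<open>phi\<close>, whether or not \<open>Inl m\<close> is singular.\<close>
      ultimately have "T_le ?\<Gamma> j ?M (T_class ?\<Gamma> j ?M (Inl m)) (T_class ?\<Gamma> j ?M (Inr q))"
        by (subst T_le_class_iff) (auto simp: singular_def)
      then show ?thesis
        by (simp add: m q(2))
    qed
  qed
  moreover have "nonneg_set w \<subseteq> nonneg_set val" "pos_set w \<subseteq> pos_set val"
    using vr(2) pos by (auto simp: nonneg_set_def pos_set_def val_nonneg_iff)
  ultimately show ?thesis
    using valuation_val valuation_extends_val by blast
qed

end
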